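(* Let $\alpha\in(0,\infty)\setminus\{1\}$ and let $W_1$ and $W_2$ be binary-input classical-quantum channels. Then there exist binary-input classical-quantum channels $\bar W_1$ and $\bar W_2$ with $\widetilde H^\downarrow_\alpha(\bar W_i)=\log 2-\widetilde H^\downarrow_\alpha(W_i)$ for $i=1,2$ such that $$\widetilde H^\downarrow_\alpha(W_1\boxplus W_2)-\tfrac12\Big(\widetilde H^\downarrow_\alpha(W_1)+\widetilde H^\downarrow_\alpha(W_2)\Big)=\widetilde H^\downarrow_\alpha(\bar W_1\boxplus\bar W_2)-\tfrac12\Big(\widetilde H^\downarrow_\alpha(\bar W_1)+\widetilde H^\downarrow_\alpha(\bar W_2)\Big).$$
   Context: All systems are finite-dimensional; powers of positive semidefinite matrices (including negative ones) are taken on the support; $\rho_B^s$ inside an expression on $AB$ means $I_A\otimes\rho_B^s$; $\log$ is natural. For $\alpha\in(0,\infty)\setminus\{1\}$ and a state $\rho_{AB}$, $$\widetilde H^\downarrow_\alpha(A|B)_\rho=\frac{1}{1-\alpha}\log\operatorname{Tr}\Big[\Big(\rho_B^{\frac{1-\alpha}{2\alpha}}\rho_{AB}\,\rho_B^{\frac{1-\alpha}{2\alpha}}\Big)^\alpha\Big].$$ A binary-input classical-quantum channel $W$ is identified with a classical-quantum state with uniform input, $\rho^{XB}=\frac12|0\rangle\langle0|\otimes\sigma_0^B+\frac12|1\rangle\langle1|\otimes\sigma_1^B$, where $\sigma_0^B,\sigma_1^B$ are quantum states on a finite-dimensional system $B$ (the output systems of different channels, including those of $\bar W_i$ and $W_i$,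 may differ), and $\widetilde H^\downarrow_\alpha(W)=\widetilde H^\downarrow_\alpha(X|B)_\rho$. For channels $W_1$ with output states $\sigma_x^{B_1}$ and $W_2$ with output states $\sigma_x^{B_2}$ let $$\tau^{(X_1+X_2)X_2B_1B_2}=\sum_{x_1,x_2\in\{0,1\}}\tfrac14\,|x_1\oplus x_2\rangle\langle x_1\oplus x_2|\otimes|x_2\rangle\langle x_2|\otimes\sigma_{x_1}^{B_1}\otimes\sigma_{x_2}^{B_2},$$ and $\widetilde H^\downarrow_\alpha(W_1\boxplus W_2)=\widetilde H^\downarrow_\alpha(X_1+X_2|B_1B_2)_\tau$. *)

theory Defs
  imports Complex_Main "Jordan_Normal_Form.Schur_Decomposition"
begin

subsection \<open>Matrices and states\<close>

text \<open>An operator on a \<open>d\<close>-dimensional system is an element of \<open>carrier_mat d d\<close>.\<close>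

definition mat_trace :: "complex mat \<Rightarrow> complex" where
  "mat_trace A = (\<Sum>i<dim_row A. A $$ (i, i))"

text \<open>In the order on \<open>complex\<close>, \<open>0 \<le> z\<close> says that \<open>z\<close> is real and nonnegative.\<close>

definition psd_mat :: "nat \<Rightarrow> complex mat \<Rightarrow> bool" where
  "psd_mat n A \<longleftrightarrow> A \<in> carrier_mat n n \<and> (\<forall>v\<in>carrier_vec n. 0 \<le> (A *\<^sub>v v) \<bullet>c v)"

definition quantum_state :: "nat \<Rightarrow> complex mat \<Rightarrow> bool" where
  "quantum_state n \<rho> \<longleftrightarrow> psd_mat n \<rho> \<and> mat_trace \<rho> = 1"

definition unitary_mat :: "nat \<Rightarrow> complex mat \<Rightarrow> bool" where
  "unitary_mat n U \<longleftrightarrow>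
     U \<in> carrier_mat n n \<and> mat_adjoint U * U = 1\<^sub>m n \<and> U * mat_adjoint U = 1\<^sub>m n"


subsection \<open>Real powers of positive semidefinite matrices\<close>

text \<open>Since \<open>0 powr s = 0\<close> for every real \<open>s\<close> (also for \<open>s \<le> 0\<close>), the power is taken on the
  support. It does not depend on the choice of the spectral decomposition, see
  \<open>psd_powr_eqI\<close> below.\<close>

definition is_psd_powr :: "complex mat \<Rightarrow> real \<Rightarrow> complex mat \<Rightarrow> bool" where
  "is_psd_powr A s B \<longleftrightarrow> (\<exists>n U (d :: nat \<Rightarrow> real).
     unitary_mat n U \<and> (\<forall>i<n. 0 \<le> d i) \<and>
     A = U * mat_diag n (\<lambda>i. complex_of_real (d i)) * mat_adjoint U \<and>
     B = U * mat_diag n (\<lambda>i. complex_of_real (d i powr s)) * mat_adjoint U)"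

definition psd_powr :: "complex mat \<Rightarrow> real \<Rightarrow> complex mat" where
  "psd_powr A s = (THE B. is_psd_powr A s B)"

lemma mat_adjoint_carrier: "U \<in> carrier_mat n m \<Longrightarrow> mat_adjoint U \<in> carrier_mat m n"
  unfolding mat_adjoint_def by auto

lemma mult_diag_uniq:
  fixes U V :: "complex mat"
  assumes U: "unitary_mat n U" and V: "unitary_mat n V"
    and eq: "U * mat_diag n f * mat_adjoint U = V * mat_diag n g * mat_adjoint V"
    and h: "\<And>i j. i < n \<Longrightarrow> j < n \<Longrightarrow> f i = g j \<Longrightarrow> f' i = g' j"
  shows "U * mat_diag n f' * mat_adjoint U = V * mat_diag n g' * mat_adjoint V"
proof -
  let ?U = "mat_adjoint U" and ?V = "mat_adjoint V"
  have c [simp]: "U \<in> carrier_mat n n" "V \<in> carrier_mat n n" "?U \<in> carrier_mat n n" "?V \<in> carrier_mat n n"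
    using U V by (auto simp: unitary_mat_def mat_adjoint_carrier)
  have u: "?U * U = 1\<^sub>m n" "U * ?U = 1\<^sub>m n" "?V * V = 1\<^sub>m n" "V * ?V = 1\<^sub>m n"
    using U V by (auto simp: unitary_mat_def)
  define X where "X = ?V * U"
  have X [simp]: "X \<in> carrier_mat n n" unfolding X_def by (rule mult_carrier_mat[of _ n n]) (rule c)+
  note dX = carrier_matD[OF X]
  have D [simp]: "mat_diag n k \<in> carrier_mat n n" for k :: "nat \<Rightarrow> complex" by simp
  have m [simp]: "A * B \<in> carrier_mat n n"
    if "A \<in> carrier_mat n n" "B \<in> carrier_mat n n" for A B :: "complex mat"
    using that by (rule mult_carrier_mat)
  have assoc: "A * B * C = A * (B * C)"
    if "A \<in> carrier_mat n n" "B \<in> carrier_mat n n" "C \<in> carrier_mat n n" for A B C :: "complex mat"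
    using that by (rule assoc_mult_mat)
  have canc: "?U * (U * Y) = Y" "U * (?U * Y) = Y" "?V * (V * Y) = Y" "V * (?V * Y) = Y"
    if "Y \<in> carrier_mat n n" for Y
    using that u by (simp_all flip: assoc)
  have e1: "?V * (U * mat_diag n k * ?U) * U = X * mat_diag n k" for k
    by (simp add: X_def assoc u right_mult_one_mat[of _ n n])
  have e2: "?V * (V * mat_diag n k * ?V) * U = mat_diag n k * X" for k
    by (simp add: X_def assoc canc)
  have *: "X * mat_diag n f = mat_diag n g * X"
    using e1[of f] e2[of g] eq by simp
  have **: "X $$ (i, j) * f' j = g' i * X $$ (i, j)" if "i < n" "j < n" for i j
  proof -
    have "(X * mat_diag n f) $$ (i, j) = (mat_diag n g * X) $$ (i, j)"
      using * by simp
    then have "X $$ (i, j) * f j = g i * X $$ (i, j)"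
      using that by (simp add: mat_diag_mult_left[of _ n n] mat_diag_mult_right[of _ n n])
    then show ?thesis using h[OF that(2,1)] by (cases "X $$ (i, j) = 0") auto
  qed
  have ***: "X * mat_diag n f' = mat_diag n g' * X"
    by (rule eq_matI)
      (auto simp: mat_diag_mult_left[of _ n n] mat_diag_mult_right[of _ n n] ** dX)
  have r: "V * (?V * Y * U) * ?U = Y" if "Y \<in> carrier_mat n n" for Y
    using that by (simp add: assoc canc u right_mult_one_mat[of _ n n])
  have "U * mat_diag n f' * ?U = V * (X * mat_diag n f') * ?U"
    using r[of "U * mat_diag n f' * ?U"] by (simp add: e1)
  also have "\<dots> = V * (mat_diag n g' * X) * ?U" by (simp only: ***)
  also have "\<dots> = V * mat_diag n g' * ?V"
    using r[of "V * mat_diag n g' * ?V"] by (simp add: e2)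
  finally show ?thesis .
qed

lemma is_psd_powr_unique:
  assumes "is_psd_powr A s B" "is_psd_powr A s C"
  shows "B = C"
proof -
  from assms(1) obtain n U d where 1: "unitary_mat n U"
    "A = U * mat_diag n (\<lambda>i. complex_of_real (d i)) * mat_adjoint U"
    "B = U * mat_diag n (\<lambda>i. complex_of_real (d i powr s)) * mat_adjoint U"
    unfolding is_psd_powr_def by blast
  from assms(2) obtain m V e where 2: "unitary_mat m V"
    "A = V * mat_diag m (\<lambda>i. complex_of_real (e i)) * mat_adjoint V"
    "C = V * mat_diag m (\<lambda>i. complex_of_real (e i powr s)) * mat_adjoint V"
    unfolding is_psd_powr_def by blast
  have "dim_row A = n" using 1(1) unfolding 1(2) by (auto simp: unitary_mat_def)
  moreover have "dim_row A = m" using 2(1) unfolding 2(2) by (auto simp: unitary_mat_def)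
  ultimately have "m = n" by simp
  then show ?thesis
    using mult_diag_uniq[OF 1(1) 2(1)[unfolded \<open>m = n\<close>], of "\<lambda>i. complex_of_real (d i)" "\<lambda>i. complex_of_real (e i)"
        "\<lambda>i. complex_of_real (d i powr s)" "\<lambda>i. complex_of_real (e i powr s)"] 1 2 by simp
qed

lemma psd_powr_eqI: "is_psd_powr A s B \<Longrightarrow> psd_powr A s = B"
  unfolding psd_powr_def using is_psd_powr_unique by blast


subsection \<open>Tensor products and partial traces\<close>

definition kron :: "complex mat \<Rightarrow> complex mat \<Rightarrow> complex mat" (infixl "\<otimes>\<^sub>m" 70) where
  "A \<otimes>\<^sub>m B = mat (dim_row A * dim_row B) (dim_col A * dim_col B)
     (\<lambda>(i, j). A $$ (i div dim_row B, j div dim_col B) * B $$ (i mod dim_row B, j mod dim_col B))"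

text \<open>\<open>partial_trace a c b\<close> traces out the middle factor \<open>C\<close> of a system \<open>ACB\<close> with
  dimensions \<open>a\<close>, \<open>c\<close>, \<open>b\<close>; with \<open>a = 1\<close> it traces out the first factor of \<open>CB\<close>. The basis vector
  with labels \<open>(x, k, y)\<close> has index \<open>(x * c + k) * b + y\<close>, as for \<open>\<otimes>\<^sub>m\<close>.\<close>

definition partial_trace :: "nat \<Rightarrow> nat \<Rightarrow> nat \<Rightarrow> complex mat \<Rightarrow> complex mat" where
  "partial_trace a c b M = mat (a * b) (a * b) (\<lambda>(i, j).
     \<Sum>k<c. M $$ ((i div b * c + k) * b + i mod b, (j div b * c + k) * b + j mod b))"


subsection \<open>Sandwiched conditional Renyi entropy\<close>

text \<open>\<open>\<rho>\<close> is a state on \<open>AB\<close>, where \<open>A\<close> and \<open>B\<close> have dimensions \<open>a\<close> and \<open>b\<close>. The trace below is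
  real and nonnegative, so \<open>Re\<close> only changes its type.\<close>

definition sandwiched_H_down :: "real \<Rightarrow> nat \<Rightarrow> nat \<Rightarrow> complex mat \<Rightarrow> real" where
  "sandwiched_H_down \<alpha> a b \<rho> =
     (let S = 1\<^sub>m a \<otimes>\<^sub>m psd_powr (partial_trace 1 a b \<rho>) ((1 - \<alpha>) / (2 * \<alpha>))
      in 1 / (1 - \<alpha>) * ln (Re (mat_trace (psd_powr (S * \<rho> * S) \<alpha>))))"


subsection \<open>Binary-input classical-quantum channels\<close>

text \<open>A channel is the map \<open>x \<mapsto> \<sigma>\<^sub>x\<close>; the input bits 0 and 1 are \<open>False\<close> and \<open>True\<close>, so that
  \<open>x\<^sub>1 \<oplus> x\<^sub>2\<close> is \<open>x\<^sub>1 \<noteq> x\<^sub>2\<close>.\<close>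

type_synonym bcq = "bool \<Rightarrow> complex mat"

definition out_dim :: "bcq \<Rightarrow> nat" where
  "out_dim W = dim_row (W False)"

definition bcq_channel :: "bcq \<Rightarrow> bool" where
  "bcq_channel W \<longleftrightarrow> (\<forall>x. quantum_state (out_dim W) (W x))"

definition bit_proj :: "bool \<Rightarrow> complex mat" where
  "bit_proj x = mat_diag 2 (\<lambda>i. if i = of_bool x then 1 else 0)"

definition bcq_state :: "bcq \<Rightarrow> complex mat" where
  "bcq_state W =
     (1 / 2) \<cdot>\<^sub>m (bit_proj False \<otimes>\<^sub>m W False) + (1 / 2) \<cdot>\<^sub>m (bit_proj True \<otimes>\<^sub>m W True)"

definition channel_H :: "real \<Rightarrow> bcq \<Rightarrow> real" where
  "channel_H \<alpha> W = sandwiched_H_down \<alpha> 2 (out_dim W) (bcq_state W)"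

definition box_state :: "bcq \<Rightarrow> bcq \<Rightarrow> complex mat" where
  "box_state W1 W2 =
     (let t = (\<lambda>x1 x2. (1 / 4) \<cdot>\<^sub>m (bit_proj (x1 \<noteq> x2) \<otimes>\<^sub>m bit_proj x2 \<otimes>\<^sub>m W1 x1 \<otimes>\<^sub>m W2 x2))
      in t False False + t False True + t True False + t True True)"

text \<open>The entropy \<open>H(X\<^sub>1 + X\<^sub>2 | B\<^sub>1 B\<^sub>2)\<close> is that of the marginal of \<open>box_state\<close> with the second
  factor \<open>X\<^sub>2\<close> traced out.\<close>

definition box_H :: "real \<Rightarrow> bcq \<Rightarrow> bcq \<Rightarrow> real" where
  "box_H \<alpha> W1 W2 =
     (let b = out_dim W1 * out_dim W2
      in sandwiched_H_down \<alpha> 2 b (partial_trace 2 2 b (box_state W1 W2)))"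

end

theory Submission
  imports Defs "Jordan_Normal_Form.Spectral_Radius"
begin

text \<open>Put \<open>S = \<rho>\<^sub>B\<^bsup>(1 - \<alpha>) / (2\<alpha>)\<^esup>\<close> and \<open>X\<^sub>x = S (\<sigma>\<^sub>x / 2) S\<close>, with a superscript for the channel. With
  \<open>F\<^sub>i = Tr (X\<^sub>0\<^sup>i)\<^sup>\<alpha> + Tr (X\<^sub>1\<^sup>i)\<^sup>\<alpha>\<close> the entropy of \<open>W\<^sub>i\<close> is \<open>log F\<^sub>i / (1 - \<alpha>)\<close>. The entropy of the box product
  is \<open>log G / (1 - \<alpha>)\<close>, where \<open>G\<close> sums \<open>Tr (\<cdot>)\<^sup>\<alpha>\<close> over
  \<open>X\<^sub>0\<^sup>1 \<otimes> X\<^sub>0\<^sup>2 + X\<^sub>1\<^sup>1 \<otimes> X\<^sub>1\<^sup>2\<close> and \<open>X\<^sub>0\<^sup>1 \<otimes> X\<^sub>1\<^sup>2 + X\<^sub>1\<^sup>1 \<otimes> X\<^sub>0\<^sup>2\<close>. So we want dual channels with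
  \<open>2\<^bsup>1 - \<alpha>\<^esup> / F\<^sub>i\<close> in place of \<open>F\<^sub>i\<close> and \<open>2\<^bsup>1 - \<alpha>\<^esup> G / (F\<^sub>1 F\<^sub>2)\<close> in place of \<open>G\<close>.

  To obtain them, purify the state sandwiched by \<open>S\<close>, rescale the complementary system by the power of its
  reduced state that the sandwiching on that side will undo, and measure \<open>X\<close> in the Fourier basis. In terms of
  matrices: write \<open>X\<^sub>x = L\<^sub>x L\<^sub>x\<^sup>*\<close> with \<open>L\<^sub>x\<^sup>* L\<^sub>x = D\<^sub>x\<close> diagonal, and put \<open>A = [L\<^sub>0, L\<^sub>1]\<close>, \<open>B = [L\<^sub>0, - L\<^sub>1]\<close>
  and \<open>D = D\<^sub>0 \<oplus> D\<^sub>1\<close>. The outputs of the dual channel are \<open>D\<^bsup>(\<alpha> - 1) / 2\<^esup> A\<^sup>* A D\<^bsup>(\<alpha> - 1) / 2\<^esup> / F\<close> and the same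
  with \<open>B\<close>, and sandwiching turns their halves into \<open>A\<^sup>* A\<close> and \<open>B\<^sup>* B\<close> times \<open>F\<^bsup>- 1 / \<alpha>\<^esup> / 2\<close>. Since
  \<open>A A\<^sup>* = B B\<^sup>* = X\<^sub>0 + X\<^sub>1\<close> and \<open>A B\<^sup>* = B A\<^sup>* = X\<^sub>0 - X\<^sub>1\<close>, both identities follow from
  \<open>Tr (M\<^sup>* M)\<^sup>s = Tr (M M\<^sup>*)\<^sup>s\<close>.\<close>

section \<open>Matrix algebra\<close>

text \<open>As simp rules, \<open>carrier_matD\<close> and \<open>carrier_mat_iff\<close> loop.\<close>

declare carrier_matD [simp del]

lemma carrier_mat_iff: "A \<in> carrier_mat n m \<longleftrightarrow> dim_row A = n \<and> dim_col A = m"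
  by (auto intro: carrier_matI dest: carrier_matD)

lemma dim_adjoint [simp]:
  "dim_row (mat_adjoint A) = dim_col A" "dim_col (mat_adjoint A) = dim_row A"
  by (auto simp: mat_adjoint_def)

lemma index_adjoint [simp]:
  "i < dim_col A \<Longrightarrow> j < dim_row A \<Longrightarrow> mat_adjoint A $$ (i, j) = cnj (A $$ (j, i))"
  for A :: "complex mat"
  by (simp add: mat_adjoint_def mat_of_rows_index conjugate_complex_def)

lemma adjoint_adjoint [simp]: "mat_adjoint (mat_adjoint A) = (A :: complex mat)"
  by (rule eq_matI) auto

lemma index_mult_sum:
  "i < dim_row A \<Longrightarrow> j < dim_col B \<Longrightarrow> dim_col A = dim_row B \<Longrightarrow>
   (A * B) $$ (i, j) = (\<Sum>k<dim_row B. A $$ (i, k) * B $$ (k, j))"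
  by (simp add: scalar_prod_def atLeast0LessThan)

lemma adjoint_mult:
  "dim_col A = dim_row B \<Longrightarrow> mat_adjoint (A * B) = mat_adjoint B * mat_adjoint A"
  for A B :: "complex mat"
  by (rule eq_matI) (auto simp: index_mult_sum mult.commute simp del: index_mult_mat(1))

lemma adjoint_add:
  "dim_row A = dim_row B \<Longrightarrow> dim_col A = dim_col B \<Longrightarrow>
   mat_adjoint (A + B) = mat_adjoint A + mat_adjoint B" for A B :: "complex mat"
  by (rule eq_matI) auto

lemma adjoint_minus:
  "dim_row A = dim_row B \<Longrightarrow> dim_col A = dim_col B \<Longrightarrow>
   mat_adjoint (A - B) = mat_adjoint A - mat_adjoint B" for A B :: "complex mat"
  by (rule eq_matI) auto

lemma adjoint_smult: "mat_adjoint (c \<cdot>\<^sub>m A) = cnj c \<cdot>\<^sub>m mat_adjoint A" for A :: "complex mat"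
  by (rule eq_matI) auto

lemma dim_mat_diag [simp]: "dim_row (mat_diag n f) = n" "dim_col (mat_diag n f) = n"
  by (auto simp: mat_diag_def)

lemma index_mat_diag [simp]:
  "i < n \<Longrightarrow> j < n \<Longrightarrow> mat_diag n f $$ (i, j) = (if i = j then f j else 0)"
  by (simp add: mat_diag_def)

lemma adjoint_diag [simp]: "mat_adjoint (mat_diag n f) = mat_diag n (\<lambda>i. cnj (f i))"
  by (rule eq_matI) auto

lemma mult_assoc_dim:
  "dim_col A = dim_row B \<Longrightarrow> dim_col B = dim_row C \<Longrightarrow> A * B * C = A * (B * C)"
  for A B C :: "complex mat"
  by (rule assoc_mult_mat[of A "dim_row A" "dim_row B" B "dim_row C" C "dim_col C"]) (rule carrier_matI; simp)+

lemma mult_add_dim: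
  "dim_col A = dim_row B \<Longrightarrow> dim_row B = dim_row C \<Longrightarrow> dim_col B = dim_col C \<Longrightarrow>
   A * (B + C) = A * B + A * C" for A B C :: "complex mat"
  by (rule mult_add_distrib_mat[of _ "dim_row A" "dim_row B" _ "dim_col B"]) (rule carrier_matI; simp)+

lemma add_mult_dim:
  "dim_row A = dim_row B \<Longrightarrow> dim_col A = dim_col B \<Longrightarrow> dim_col A = dim_row C \<Longrightarrow>
   (A + B) * C = A * C + B * C" for A B C :: "complex mat"
  by (rule add_mult_distrib_mat[of _ "dim_row A" "dim_col A" _ _ "dim_col C"]) (rule carrier_matI; simp)+

lemma mult_minus_dim:
  "dim_col A = dim_row B \<Longrightarrow> dim_row B = dim_row C \<Longrightarrow> dim_col B = dim_col C \<Longrightarrow>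
   A * (B - C) = A * B - A * C" for A B C :: "complex mat"
  by (rule mult_minus_distrib_mat[of _ "dim_row A" "dim_row B" _ "dim_col B"]) (rule carrier_matI; simp)+

lemma minus_mult_dim:
  "dim_row A = dim_row B \<Longrightarrow> dim_col A = dim_col B \<Longrightarrow> dim_col A = dim_row C \<Longrightarrow>
   (A - B) * C = A * C - B * C" for A B C :: "complex mat"
  by (rule minus_mult_distrib_mat[of _ "dim_row A" "dim_col A" _ _ "dim_col C"]) (rule carrier_matI; simp)+

lemma smult_mult_dim: "dim_col A = dim_row B \<Longrightarrow> (c \<cdot>\<^sub>m A) * B = c \<cdot>\<^sub>m (A * B)"
  for A B :: "complex mat"
  by (rule eq_matI) auto

lemma mult_smult_dim: "dim_col A = dim_row B \<Longrightarrow> A * (c \<cdot>\<^sub>m B) = c \<cdot>\<^sub>m (A * B)"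
  for A B :: "complex mat"
  by (rule eq_matI) auto

lemma one_mult_dim [simp]: "dim_row A = n \<Longrightarrow> 1\<^sub>m n * A = (A :: complex mat)"
  by (rule left_mult_one_mat[of _ n "dim_col A"]) (rule carrier_matI; simp)

lemma mult_one_dim [simp]: "dim_col A = n \<Longrightarrow> A * 1\<^sub>m n = (A :: complex mat)"
  by (rule right_mult_one_mat[of _ "dim_row A"]) (rule carrier_matI; simp)

lemma diag_mult_left:
  "dim_row A = n \<Longrightarrow> i < n \<Longrightarrow> j < dim_col A \<Longrightarrow> (mat_diag n f * A) $$ (i, j) = f i * A $$ (i, j)"
  for A :: "complex mat"
  by (subst mat_diag_mult_left[of _ n "dim_col A"]) auto

lemma diag_mult_right:
  "dim_col A = n \<Longrightarrow> i < dim_row A \<Longrightarrow> j < n \<Longrightarrow> (A * mat_diag n f) $$ (i, j) = A $$ (i, j) * f j"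
  for A :: "complex mat"
  by (subst mat_diag_mult_right[of _ "dim_row A" n]) auto

lemma unitary_dims: "unitary_mat n U \<Longrightarrow> dim_row U = n" "unitary_mat n U \<Longrightarrow> dim_col U = n"
  by (auto simp: unitary_mat_def)

lemma unitary_eqs:
  "unitary_mat n U \<Longrightarrow> mat_adjoint U * U = 1\<^sub>m n" "unitary_mat n U \<Longrightarrow> U * mat_adjoint U = 1\<^sub>m n"
  by (auto simp: unitary_mat_def)

lemma unitary_cancel:
  "unitary_mat n U \<Longrightarrow> dim_row X = n \<Longrightarrow> mat_adjoint U * (U * X) = X"
  "unitary_mat n U \<Longrightarrow> dim_row X = n \<Longrightarrow> U * (mat_adjoint U * X) = X"
  by (simp_all flip: mult_assoc_dim add: unitary_dims unitary_eqs)

lemma unitary_mult: "unitary_mat n U \<Longrightarrow> unitary_mat n V \<Longrightarrow> unitary_mat n (U * V)"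
  unfolding unitary_mat_def carrier_mat_iff
  by (auto simp: adjoint_mult mult_assoc_dim unitary_cancel[of n] unitary_mat_def carrier_mat_iff)

section \<open>Kronecker products\<close>

lemma dim_kron [simp]:
  "dim_row (A \<otimes>\<^sub>m B) = dim_row A * dim_row B" "dim_col (A \<otimes>\<^sub>m B) = dim_col A * dim_col B"
  by (auto simp: kron_def)

lemma index_kron [simp]:
  "i < dim_row A * dim_row B \<Longrightarrow> j < dim_col A * dim_col B \<Longrightarrow>
   (A \<otimes>\<^sub>m B) $$ (i, j) = A $$ (i div dim_row B, j div dim_col B) * B $$ (i mod dim_row B, j mod dim_col B)"
  by (simp add: kron_def)

lemma mod_less_of_mult: "i < a * b \<Longrightarrow> i mod b < (b::nat)"
  by (cases "b = 0") auto

text \<open>Quotient and remainder by \<open>b\<close> identify \<open>{..<a * b}\<close> with pairs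
  of indices; this is how the index of a Kronecker product is split. For \<open>b = 0\<close> both
  sides are 0.\<close>

lemma sum_div_mod:
  fixes f :: "nat \<Rightarrow> nat \<Rightarrow> 'a::comm_monoid_add"
  shows "(\<Sum>k<a * b. f (k div b) (k mod b)) = (\<Sum>i<a. \<Sum>j<b. f i j)"
proof (cases "b = 0")
  case False
  have "(\<Sum>i<a. \<Sum>j<b. f i j) = (\<Sum>(i, j)\<in>{..<a} \<times> {..<b}. f i j)"
    by (simp add: sum.cartesian_product)
  also have "\<dots> = (\<Sum>k<a * b. f (k div b) (k mod b))"
  proof (rule sum.reindex_bij_witness[where j = "\<lambda>(i, j). i * b + j" and i = "\<lambda>k. (k div b, k mod b)"])
    fix p assume p: "p \<in> {..<a} \<times> {..<b}"
    then obtain i j where ij: "p = (i, j)" "i < a" "j < b" by auto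
    have "i * b + j < Suc i * b" using ij by simp
    also have "\<dots> \<le> a * b" using ij by (intro mult_le_mono1) auto
    finally show "(case p of (i, j) \<Rightarrow> i * b + j) \<in> {..<a * b}" using ij by simp
  qed (use False in \<open>auto simp: less_mult_imp_div_less\<close>)
  finally show ?thesis by simp
qed simp

text \<open>The inner summation index splits into its two digits, and the resulting double sum
  factors.\<close>

lemma kron_mult:
  assumes "dim_col A = dim_row C" "dim_col B = dim_row D"
  shows "(A \<otimes>\<^sub>m B) * (C \<otimes>\<^sub>m D) = (A * C) \<otimes>\<^sub>m (B * D)"
proof (rule eq_matI)
  fix i j
  assume "i < dim_row ((A * C) \<otimes>\<^sub>m (B * D))" "j < dim_col ((A * C) \<otimes>\<^sub>m (B * D))"
  then have i: "i < dim_row A * dim_row B" and j: "j < dim_col C * dim_col D" by auto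
  define ai bi cj dj where "ai = i div dim_row B" and "bi = i mod dim_row B"
    and "cj = j div dim_col D" and "dj = j mod dim_col D"
  have lt: "ai < dim_row A" "bi < dim_row B" "cj < dim_col C" "dj < dim_col D"
    using i j by (simp_all add: ai_def bi_def cj_def dj_def less_mult_imp_div_less mod_less_of_mult)
  have "((A \<otimes>\<^sub>m B) * (C \<otimes>\<^sub>m D)) $$ (i, j) =
    (\<Sum>k<dim_row C * dim_row D. (\<lambda>k l. A $$ (ai, k) * B $$ (bi, l) * (C $$ (k, cj) * D $$ (l, dj)))
       (k div dim_row D) (k mod dim_row D))"
    using i j assms by (subst index_mult_sum) (auto simp: ai_def bi_def cj_def dj_def intro!: sum.cong)
  also have "\<dots> = (\<Sum>k<dim_row C. \<Sum>l<dim_row D. A $$ (ai, k) * B $$ (bi, l) * (C $$ (k, cj) * D $$ (l, dj)))"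
    by (rule sum_div_mod)
  also have "\<dots> = (\<Sum>k<dim_row C. A $$ (ai, k) * C $$ (k, cj)) * (\<Sum>l<dim_row D. B $$ (bi, l) * D $$ (l, dj))"
    by (simp add: sum_product mult_ac)
  also have "\<dots> = (A * C) $$ (ai, cj) * (B * D) $$ (bi, dj)"
    using lt assms by (simp only: index_mult_sum)
  also have "\<dots> = ((A * C) \<otimes>\<^sub>m (B * D)) $$ (i, j)"
    using i j by (simp add: ai_def bi_def cj_def dj_def)
  finally show "((A \<otimes>\<^sub>m B) * (C \<otimes>\<^sub>m D)) $$ (i, j) = ((A * C) \<otimes>\<^sub>m (B * D)) $$ (i, j)" .
qed auto

lemma adjoint_kron: "mat_adjoint (A \<otimes>\<^sub>m B) = mat_adjoint A \<otimes>\<^sub>m mat_adjoint B"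
  by (rule eq_matI) (auto simp: less_mult_imp_div_less mod_less_of_mult)

lemma kron_smult_right: "A \<otimes>\<^sub>m (c \<cdot>\<^sub>m B) = c \<cdot>\<^sub>m (A \<otimes>\<^sub>m B)"
  by (rule eq_matI) (auto simp: less_mult_imp_div_less mod_less_of_mult)

lemma kron_assoc: "A \<otimes>\<^sub>m B \<otimes>\<^sub>m C = A \<otimes>\<^sub>m (B \<otimes>\<^sub>m C)"
proof (rule eq_matI)
  fix i j
  assume "i < dim_row (A \<otimes>\<^sub>m (B \<otimes>\<^sub>m C))" "j < dim_col (A \<otimes>\<^sub>m (B \<otimes>\<^sub>m C))"
  then have ij: "i < dim_row A * (dim_row B * dim_row C)" "j < dim_col A * (dim_col B * dim_col C)"
    "i < dim_row A * dim_row B * dim_row C" "j < dim_col A * dim_col B * dim_col C"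
    by (simp_all add: mult.assoc)
  \<comment> \<open>Both bracketings read off the same three mixed-radix digits of an index.\<close>
  have m: "k mod (m * l) div l = k div l mod m" "k mod (m * l) mod l = k mod l" "k div (m * l) = k div l div m"
    for k m l :: nat
    by (cases "l = 0"; simp add: mult.commute[of m] mod_mult2_eq div_mult2_eq)+
  show "(A \<otimes>\<^sub>m B \<otimes>\<^sub>m C) $$ (i, j) = (A \<otimes>\<^sub>m (B \<otimes>\<^sub>m C)) $$ (i, j)"
    using ij by (simp add: less_mult_imp_div_less mod_less_of_mult m mult.assoc)
qed (simp_all add: mult.assoc)

lemma div_mod_eq_iff: "i div m = j div m \<and> i mod m = j mod m \<longleftrightarrow> i = (j :: nat)"
  by (metis div_mult_mod_eq)

lemma kron_diag:
  "mat_diag n f \<otimes>\<^sub>m mat_diag m g = mat_diag (n * m) (\<lambda>i. f (i div m) * g (i mod m))"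
proof (rule eq_matI)
  fix i j assume "i < dim_row (mat_diag (n * m) (\<lambda>i. f (i div m) * g (i mod m)))"
    "j < dim_col (mat_diag (n * m) (\<lambda>i. f (i div m) * g (i mod m)))"
  then show "(mat_diag n f \<otimes>\<^sub>m mat_diag m g) $$ (i, j) =
      mat_diag (n * m) (\<lambda>i. f (i div m) * g (i mod m)) $$ (i, j)"
    using div_mod_eq_iff[of i m j] by (auto simp: less_mult_imp_div_less mod_less_of_mult)
qed auto

lemma kron_one: "1\<^sub>m n \<otimes>\<^sub>m 1\<^sub>m m = 1\<^sub>m (n * m)"
  using kron_diag[of n "\<lambda>_. 1" m "\<lambda>_. 1"] by simp

lemma unitary_kron: "unitary_mat n U \<Longrightarrow> unitary_mat m V \<Longrightarrow> unitary_mat (n * m) (U \<otimes>\<^sub>m V)"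
  by (auto simp: unitary_mat_def carrier_mat_iff adjoint_kron kron_mult kron_one)

lemma trace_kron:
  assumes "dim_row A = dim_col A" "dim_row B = dim_col B"
  shows "mat_trace (A \<otimes>\<^sub>m B) = mat_trace A * mat_trace B"
  using assms sum_div_mod[where f = "\<lambda>k l. A $$ (k, k) * B $$ (l, l)" and a = "dim_row A" and b = "dim_row B"]
  by (simp add: mat_trace_def sum_product)

section \<open>The spectral theorem\<close>

text \<open>A classical bit next to a quantum system gives a block diagonal matrix, so sandwiching
  and traces of powers can be taken block by block.\<close>

definition direct_sum :: "complex mat \<Rightarrow> complex mat \<Rightarrow> complex mat" (infixl "\<oplus>\<^sub>m" 65) where
  "A \<oplus>\<^sub>m B = four_block_mat A (0\<^sub>m (dim_row A) (dim_col B)) (0\<^sub>m (dim_row B) (dim_col A)) B"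

lemma dim_direct_sum [simp]:
  "dim_row (A \<oplus>\<^sub>m B) = dim_row A + dim_row B" "dim_col (A \<oplus>\<^sub>m B) = dim_col A + dim_col B"
  by (auto simp: direct_sum_def)

lemma index_direct_sum [simp]:
  "i < dim_row A + dim_row B \<Longrightarrow> j < dim_col A + dim_col B \<Longrightarrow> (A \<oplus>\<^sub>m B) $$ (i, j) =
    (if i < dim_row A then if j < dim_col A then A $$ (i, j) else 0
     else if j < dim_col A then 0 else B $$ (i - dim_row A, j - dim_col A))"
  by (auto simp: direct_sum_def)

lemma direct_sum_mult:
  assumes "dim_col A = dim_row C" "dim_col B = dim_row D"
  shows "(A \<oplus>\<^sub>m B) * (C \<oplus>\<^sub>m D) = A * C \<oplus>\<^sub>m B * D"
  unfolding direct_sum_def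
  by (subst mult_four_block_mat[of _ "dim_row A" "dim_col A" _ "dim_col B" _ "dim_row B" _ _
        "dim_col C" _ "dim_col D"]) (auto simp: assms carrier_mat_iff intro!: cong_four_block_mat)

lemma adjoint_direct_sum: "mat_adjoint (A \<oplus>\<^sub>m B) = mat_adjoint A \<oplus>\<^sub>m mat_adjoint B"
  by (rule eq_matI) auto

lemma direct_sum_one: "1\<^sub>m n \<oplus>\<^sub>m 1\<^sub>m m = 1\<^sub>m (n + m)"
  by (rule eq_matI) auto

lemma direct_sum_diag:
  "mat_diag n f \<oplus>\<^sub>m mat_diag m g = mat_diag (n + m) (\<lambda>i. if i < n then f i else g (i - n))"
  by (rule eq_matI) auto

lemma unitary_direct_sum: "unitary_mat n U \<Longrightarrow> unitary_mat m V \<Longrightarrow> unitary_mat (n + m) (U \<oplus>\<^sub>m V)"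
  by (auto simp: unitary_mat_def carrier_mat_iff adjoint_direct_sum direct_sum_mult direct_sum_one)

section \<open>Positive semidefinite matrices\<close>

lemma psd_mat_iff:
  "psd_mat n A \<longleftrightarrow> dim_row A = n \<and> dim_col A = n \<and>
     (\<forall>f. 0 \<le> (\<Sum>i<n. \<Sum>j<n. cnj (f i) * A $$ (i, j) * f j))"
proof -
  have eq: "(A *\<^sub>v v) \<bullet>c v = (\<Sum>i<n. \<Sum>j<n. cnj (v $ i) * A $$ (i, j) * v $ j)"
    if "A \<in> carrier_mat n n" "v \<in> carrier_vec n" for v
    using that
    by (auto simp: scalar_prod_def atLeast0LessThan carrier_matD[OF that(1)] sum_distrib_right sum_distrib_left mult_ac
        conjugate_complex_def intro!: sum.cong)
  show ?thesis
  proof (cases "A \<in> carrier_mat n n")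
    case True
    have "(\<forall>v\<in>carrier_vec n. 0 \<le> (A *\<^sub>v v) \<bullet>c v) \<longleftrightarrow>
      (\<forall>f. 0 \<le> (\<Sum>i<n. \<Sum>j<n. cnj (f i) * A $$ (i, j) * f j))" (is "?L \<longleftrightarrow> ?R")
    proof
      assume ?L
      show ?R
      proof
        fix f
        have "0 \<le> (A *\<^sub>v vec n f) \<bullet>c vec n f" using \<open>?L\<close> by simp
        then show "0 \<le> (\<Sum>i<n. \<Sum>j<n. cnj (f i) * A $$ (i, j) * f j)"
          using eq[OF True, of "vec n f"] by simp
      qed
    next
      assume ?R
      then show ?L using eq[OF True] by simp
    qed
    then show ?thesis using True by (auto simp: psd_mat_def)
  qed (auto simp: psd_mat_def)
qed

lemma psd_dims: "psd_mat n A \<Longrightarrow> dim_row A = n" "psd_mat n A \<Longrightarrow> dim_col A = n"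
  by (auto simp: psd_mat_iff)

lemma psd_mat_form: "psd_mat n A \<Longrightarrow> 0 \<le> (\<Sum>i<n. \<Sum>j<n. cnj (f i) * A $$ (i, j) * f j)"
  by (simp add: psd_mat_iff)

text \<open>The test vector is the \<open>i\<close>-th unit vector.\<close>

lemma psd_mat_diag_nonneg:
  assumes "psd_mat n A" "i < n"
  shows "0 \<le> A $$ (i, i)"
  using psd_mat_form[OF assms(1), of "\<lambda>k. if k = i then 1 else 0"] assms(2)
  by (simp add: if_distrib[of "\<lambda>x. x * _"] if_distrib[of "\<lambda>x. _ * x"] if_distrib[of cnj] cong: if_cong)

text \<open>The quadratic form at \<open>f\<close> is the squared norm of M^* f, the vector with
  entries \<open>h k\<close>.\<close>

lemma psd_mat_gram:
  assumes "dim_row M = n"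
  shows "psd_mat n (M * mat_adjoint M)"
proof -
  have "0 \<le> (\<Sum>i<n. \<Sum>j<n. cnj (f i) * (M * mat_adjoint M) $$ (i, j) * f j)" for f
  proof -
    define h where "h k = (\<Sum>j<n. cnj (M $$ (j, k)) * f j)" for k
    have "(\<Sum>i<n. \<Sum>j<n. cnj (f i) * (M * mat_adjoint M) $$ (i, j) * f j) =
      (\<Sum>i<n. \<Sum>j<n. \<Sum>k<dim_col M. cnj (f i) * (M $$ (i, k) * cnj (M $$ (j, k))) * f j)"
      using assms by (auto simp: index_mult_sum sum_distrib_left sum_distrib_right
          simp del: index_mult_mat(1) intro!: sum.cong)
    also have "\<dots> = (\<Sum>i<n. \<Sum>k<dim_col M. \<Sum>j<n. cnj (f i) * (M $$ (i, k) * cnj (M $$ (j, k))) * f j)"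
      by (rule sum.cong[OF refl]) (rule sum.swap)
    also have "\<dots> = (\<Sum>k<dim_col M. \<Sum>i<n. \<Sum>j<n. cnj (f i) * (M $$ (i, k) * cnj (M $$ (j, k))) * f j)"
      by (rule sum.swap)
    also have "\<dots> = (\<Sum>k<dim_col M. (\<Sum>i<n. cnj (f i) * M $$ (i, k)) * h k)"
      by (simp add: h_def sum_product mult.assoc)
    also have "\<dots> = (\<Sum>k<dim_col M. cnj (h k) * h k)"
      by (simp add: h_def mult.commute)
    also have "\<dots> = (\<Sum>k<dim_col M. of_real ((cmod (h k))\<^sup>2))"
      by (metis (no_types) complex_norm_square mult.commute)
    also have "\<dots> \<ge> 0"
      by (rule sum_nonneg) (simp add: less_eq_complex_def)
    finally show ?thesis .
  qed
  with assms show ?thesis by (simp add: psd_mat_iff)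
qed

lemma psd_mat_gram': "dim_col M = n \<Longrightarrow> psd_mat n (mat_adjoint M * M)"
  using psd_mat_gram[of "mat_adjoint M" n] by simp

lemma psd_mat_add: "psd_mat n A \<Longrightarrow> psd_mat n B \<Longrightarrow> psd_mat n (A + B)"
  by (auto simp: psd_mat_iff algebra_simps sum.distrib)

lemma psd_mat_smult: "psd_mat n A \<Longrightarrow> 0 \<le> c \<Longrightarrow> psd_mat n (complex_of_real c \<cdot>\<^sub>m A)"
  unfolding psd_mat_iff
proof safe
  fix f assume *: "\<forall>f. 0 \<le> (\<Sum>i<dim_row A. \<Sum>j<dim_row A. cnj (f i) * A $$ (i, j) * f j)" "0 \<le> c"
    "dim_col A = dim_row A"
  have "(\<Sum>i<dim_row A. \<Sum>j<dim_row A. cnj (f i) * (complex_of_real c \<cdot>\<^sub>m A) $$ (i, j) * f j) =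
    of_real c * (\<Sum>i<dim_row A. \<Sum>j<dim_row A. cnj (f i) * A $$ (i, j) * f j)"
    using *(3) by (auto simp: sum_distrib_left mult_ac intro!: sum.cong)
  also have "\<dots> \<ge> 0"
    using *(1,2) by (simp add: less_eq_complex_def)
  finally show "0 \<le> (\<Sum>i<dim_row A. \<Sum>j<dim_row A. cnj (f i) * (complex_of_real c \<cdot>\<^sub>m A) $$ (i, j) * f j)" .
qed auto

text \<open>Polarization: the form is real on all vectors supported on \<open>i\<close> and
  \<open>j\<close>, which determines how the two off-diagonal entries are related.\<close>

lemma psd_mat_hermitian:
  assumes "psd_mat n A"
  shows "mat_adjoint A = A"
proof (rule eq_matI)
  have dims: "dim_row A = n" "dim_col A = n" using assms by (auto simp: psd_mat_iff)
  fix i j assume "i < dim_row A" "j < dim_col A"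
  with dims have ij: "i < n" "j < n" by auto
  have Q: "0 \<le> cnj a * A $$ (i, i) * a + cnj a * A $$ (i, j) * b + cnj b * A $$ (j, i) * a + cnj b * A $$ (j, j) * b"
    (is "0 \<le> ?q") for a b
  proof -
    \<comment> \<open>The two contributions are added, so the expansion stays valid for
      \<open>i = j\<close>.\<close>
    define f where "f k = (if k = i then a else 0) + (if k = j then b else 0)" for k
    have "(\<Sum>i<n. \<Sum>j<n. cnj (f i) * A $$ (i, j) * f j) = ?q"
      using ij by (simp add: f_def if_distrib[of cnj] distrib_left distrib_right sum.distrib
          if_distrib[of "\<lambda>x. x * _"] if_distrib[of "\<lambda>x. _ * x"] sum.delta cong: if_cong)
    with psd_mat_form[OF assms, of f] show ?thesis by simp
  qed
  have d: "Im (A $$ (i, i)) = 0" "Im (A $$ (j, j)) = 0"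
    using Q[of 1 0] Q[of 0 1] by (auto simp: less_eq_complex_def)
  \<comment> \<open>Weights 1 and 1 compare the imaginary parts, weights 1 and \<open>\<i>\<close>
    the real parts.\<close>
  have "Im (A $$ (i, j)) + Im (A $$ (j, i)) = 0" "Re (A $$ (i, j)) - Re (A $$ (j, i)) = 0"
    using Q[of 1 1] Q[of 1 \<i>] d by (auto simp: less_eq_complex_def)
  then show "mat_adjoint A $$ (i, j) = A $$ (i, j)"
    using ij dims by (simp add: complex_eq_iff)
qed (use assms in \<open>auto simp: psd_mat_iff\<close>)

section \<open>Unitary diagonalization\<close>

text \<open>Complete \<open>v\<close> to a basis, orthogonalize by Gram-Schmidt and normalize.
  Gram-Schmidt keeps the first vector, so the first column of \<open>U\<close> is a multiple of
  \<open>v\<close>.\<close>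

lemma unitary_completion:
  fixes v :: "complex vec"
  assumes v: "v \<in> carrier_vec n" and v0: "v \<noteq> 0\<^sub>v n"
  shows "\<exists>U c. unitary_mat n U \<and> (\<forall>i<n. U $$ (i, 0) = v $ i * c)"
proof -
  interpret cof_vec_space n "TYPE(complex)" .
  define b where "b = basis_completion v"
  define ws where "ws = gram_schmidt n b"
  define W where "W = mat_of_cols n ws"
  have n: "n \<noteq> 0" using v v0 by (auto intro: eq_vecI)
  from basis_completion[OF v v0, folded b_def]
  have dist_b: "distinct b" and indep: "\<not> lin_dep (set b)" and b: "set b \<subseteq> carrier_vec n"
    and hdb: "hd b = v" and len_b: "length b = n" by auto
  from hdb len_b n obtain vs where bv: "b = v # vs" by (cases b) auto
  from gram_schmidt_result[OF b dist_b indep refl, folded ws_def]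
  have ws: "set ws \<subseteq> carrier_vec n" "corthogonal ws" "length ws = n"
    by (auto simp: len_b)
  from gram_schmidt_hd[OF v, of vs, folded bv] have hdws: "hd ws = v" unfolding ws_def .
  have ws0: "ws ! 0 = v"
    using ws(3) n hdws by (cases ws) auto
  have W: "dim_row W = n" "dim_col W = n" using ws by (auto simp: W_def)
  define B where "B = mat_adjoint W * W"
  have dB: "dim_row B = n" "dim_col B = n" using W by (auto simp: B_def)
  \<comment> \<open>Besides orthogonality of the columns this says that no diagonal entry of the
    Gram matrix \<open>B\<close> vanishes, which makes these entries strictly positive
    below.\<close>
  have "corthogonal_mat W" unfolding W_def by (rule orthogonal_mat_of_cols) (use ws in auto)
  then have B: "B $$ (i, j) = 0 \<longleftrightarrow> i \<noteq> j" if "i < n" "j < n" for i j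
    using that dB W by (auto simp: corthogonal_mat_def Let_def diagonal_mat_def B_def simp del: index_mult_mat(1))
  have Bpos: "B $$ (i, i) = of_real (Re (B $$ (i, i)))" "0 < Re (B $$ (i, i))" if "i < n" for i
  proof -
    have "psd_mat n B" unfolding B_def using W by (intro psd_mat_gram') auto
    from psd_mat_diag_nonneg[OF this that] B[OF that that] show "B $$ (i, i) = of_real (Re (B $$ (i, i)))" "0 < Re (B $$ (i, i))"
      by (auto simp: less_eq_complex_def complex_eq_iff)
  qed
  \<comment> \<open>The inverse lengths of the columns of \<open>W\<close>.\<close>
  define e where "e i = complex_of_real (1 / sqrt (Re (B $$ (i, i))))" for i
  define U where "U = W * mat_diag n e"
  have dU: "dim_row U = n" "dim_col U = n" using W by (auto simp: U_def)
  have "mat_adjoint U * U = mat_diag n (\<lambda>i. cnj (e i)) * (B * mat_diag n e)"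
    using W by (simp add: U_def B_def adjoint_mult mult_assoc_dim)
  also have "\<dots> = 1\<^sub>m n"
  proof (rule eq_matI)
    fix i j assume "i < dim_row (1\<^sub>m n :: complex mat)" "j < dim_col (1\<^sub>m n :: complex mat)"
    then have ij: "i < n" "j < n" by auto
    have "(mat_diag n (\<lambda>i. cnj (e i)) * (B * mat_diag n e)) $$ (i, j) = cnj (e i) * (B $$ (i, j) * e j)"
      using ij dB by (simp add: diag_mult_left diag_mult_right del: index_mult_mat(1))
    also have "\<dots> = 1\<^sub>m n $$ (i, j)"
    proof (cases "i = j")
      case True
      obtain r where r: "B $$ (i, i) = of_real r" "0 < r" using Bpos[OF ij(1)] by blast
      have "cnj (e i) * (B $$ (i, i) * e i) = of_real (1 / sqrt r * (r * (1 / sqrt r)))"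
        by (simp only: e_def r(1) Re_complex_of_real complex_cnj_complex_of_real of_real_mult)
      also have "\<dots> = 1"
        using r(2) by (simp add: field_simps)
      finally show ?thesis using True ij by simp
    next
      case False
      then show ?thesis using B[OF ij] ij by simp
    qed
    finally show "(mat_diag n (\<lambda>i. cnj (e i)) * (B * mat_diag n e)) $$ (i, j) = 1\<^sub>m n $$ (i, j)" .
  qed (auto simp: dB)
  finally have UU: "mat_adjoint U * U = 1\<^sub>m n" .
  have "U * mat_adjoint U = 1\<^sub>m n"
    by (rule mat_mult_left_right_inverse[OF _ _ UU]) (auto simp: carrier_mat_iff dU)
  then have "unitary_mat n U" using UU dU by (simp add: unitary_mat_def carrier_mat_iff)
  moreover have "U $$ (i, 0) = v $ i * e 0" if "i < n" for i
  proof -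
    have "W $$ (i, 0) = v $ i"
      using that n ws(3) ws0 by (simp add: W_def mat_of_cols_index)
    then show ?thesis using that n W by (simp add: U_def diag_mult_right del: index_mult_mat(1))
  qed
  ultimately show ?thesis by blast
qed

text \<open>Deflation: with a unitary whose first column is proportional to an eigenvector,
  \<open>A\<close> is conjugate to a matrix with first column (e, 0, ..., 0). Being hermitian, that
  matrix is the direct sum of \<open>e\<close> and a smaller hermitian block, to which the induction
  hypothesis applies.\<close>

lemma hermitian_spectral:
  assumes "A \<in> carrier_mat n n" "mat_adjoint A = A"
  shows "\<exists>U d. unitary_mat n U \<and> A = U * mat_diag n d * mat_adjoint U"
  using assms
proof (induction n arbitrary: A)
  case 0
  have "unitary_mat 0 (1\<^sub>m 0)"
    unfolding unitary_mat_def by (auto simp: carrier_mat_iff intro!: eq_matI)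
  moreover have "A = 1\<^sub>m 0 * mat_diag 0 (\<lambda>_. 0) * mat_adjoint (1\<^sub>m 0)"
    using 0 by (intro eq_matI) auto
  ultimately show ?case by blast
next
  case (Suc n)
  have dA: "dim_row A = Suc n" "dim_col A = Suc n" using Suc.prems by auto
  from spectrum_non_empty[OF Suc.prems(1)] obtain e where "eigenvalue A e"
    by (auto simp: spectrum_def)
  then obtain v where v: "v \<in> carrier_vec (Suc n)" "v \<noteq> 0\<^sub>v (Suc n)" and ev: "A *\<^sub>v v = e \<cdot>\<^sub>v v"
    using dA by (auto simp: eigenvalue_def eigenvector_def)
  obtain U c where U: "unitary_mat (Suc n) U" and col: "\<And>i. i < Suc n \<Longrightarrow> U $$ (i, 0) = v $ i * c"
    using unitary_completion[OF v] by blast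
  note dU = unitary_dims[OF U]
  define B where "B = mat_adjoint U * (A * U)"
  have dB: "dim_row B = Suc n" "dim_col B = Suc n" using dU by (auto simp: B_def)
  have B_herm: "mat_adjoint B = B"
    using dU dA Suc.prems(2) by (simp add: B_def adjoint_mult mult_assoc_dim)
  have AU: "(A * U) $$ (k, 0) = e * U $$ (k, 0)" if "k < Suc n" for k
  proof -
    have "(A * U) $$ (k, 0) = (\<Sum>l<Suc n. A $$ (k, l) * v $ l) * c"
      using that dU dA col by (subst index_mult_sum) (auto simp: sum_distrib_right mult.assoc simp del: sum.lessThan_Suc)
    also have "(\<Sum>l<Suc n. A $$ (k, l) * v $ l) = (A *\<^sub>v v) $ k"
      using that dA v by (simp add: scalar_prod_def atLeast0LessThan del: sum.lessThan_Suc)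
    finally show ?thesis using that v col by (simp add: ev)
  qed
  have B0: "B $$ (i, 0) = (if i = 0 then e else 0)" if "i < Suc n" for i
  proof -
    have "B $$ (i, 0) = (\<Sum>k<Suc n. mat_adjoint U $$ (i, k) * (e * U $$ (k, 0)))"
      unfolding B_def using that dU dA
      by (subst index_mult_sum) (auto simp: AU simp del: index_mult_mat(1) sum.lessThan_Suc intro!: sum.cong)
    also have "\<dots> = e * (mat_adjoint U * U) $$ (i, 0)"
      using that dU by (subst index_mult_sum) (auto simp: sum_distrib_left mult_ac simp del: sum.lessThan_Suc)
    finally show ?thesis using that by (simp add: unitary_eqs[OF U])
  qed
  have cB: "cnj (B $$ (j, i)) = B $$ (i, j)" if "i < Suc n" "j < Suc n" for i j
    using that dB B_herm by (metis index_adjoint)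
  \<comment> \<open>Hermitian symmetry carries the zeros of the first column over to the first
    row.\<close>
  have B0': "B $$ (0, i) = (if i = 0 then e else 0)" if "i < Suc n" for i
    using B0[of i] B0[of 0] cB[of 0 i] that by auto
  define C where "C = mat n n (\<lambda>(i, j). B $$ (Suc i, Suc j))"
  have "mat_adjoint C = C"
    by (rule eq_matI) (auto simp: C_def cB)
  from Suc.IH[OF _ this] obtain V d where V: "unitary_mat n V" and C: "C = V * mat_diag n d * mat_adjoint V"
    by (auto simp: C_def)
  note dV = unitary_dims[OF V]
  define V' where "V' = 1\<^sub>m 1 \<oplus>\<^sub>m V"
  define d' where "d' i = (if i < 1 then e else d (i - 1))" for i
  have one: "unitary_mat 1 (1\<^sub>m 1)"
    using adjoint_diag[of 1 "\<lambda>_. 1"] by (simp add: unitary_mat_def)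
  have V': "unitary_mat (Suc n) V'"
    using unitary_direct_sum[OF one V] by (simp add: V'_def)
  note dV' = unitary_dims[OF V']
  have "B = mat_diag 1 (\<lambda>_. e) \<oplus>\<^sub>m C"
    by (rule eq_matI) (auto simp: dB C_def B0 B0')
  also have "\<dots> = V' * mat_diag (Suc n) d' * mat_adjoint V'"
    using direct_sum_diag[of 1 "\<lambda>_. e" n d, symmetric] dV one
    by (simp add: C V'_def d'_def[abs_def] adjoint_direct_sum direct_sum_mult unitary_mat_def)
  finally have B: "B = V' * mat_diag (Suc n) d' * mat_adjoint V'" .
  have "A = U * B * mat_adjoint U"
    using dA dU by (simp add: B_def mult_assoc_dim unitary_cancel[OF U] unitary_eqs[OF U])
  also have "\<dots> = (U * V') * mat_diag (Suc n) d' * mat_adjoint (U * V')"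
    using dU dV' by (simp add: B mult_assoc_dim adjoint_mult)
  finally show ?case using unitary_mult[OF U V'] by blast
qed

text \<open>The \<open>i\<close>-th eigenvalue is the quadratic form at the \<open>i\<close>-th
  column of \<open>U\<close>, hence real and nonnegative. Beyond \<open>n\<close> the function
  \<open>d\<close> is set to 0, so it is nonnegative at every index.\<close>

lemma psd_spectral:
  assumes "psd_mat n A"
  obtains U d where "unitary_mat n U" "\<And>i. 0 \<le> d i"
    "A = U * mat_diag n (\<lambda>i. complex_of_real (d i)) * mat_adjoint U"
proof -
  have dA: "dim_row A = n" "dim_col A = n" using assms by (auto simp: psd_mat_iff)
  obtain U c where U: "unitary_mat n U" and A: "A = U * mat_diag n c * mat_adjoint U"
    using hermitian_spectral[of A n] psd_mat_hermitian[OF assms] dA by (auto simp: carrier_mat_iff)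
  note dU = unitary_dims[OF U]
  have D: "mat_diag n c = mat_adjoint U * (A * U)"
    using dU by (simp add: A mult_assoc_dim unitary_cancel[OF U] unitary_eqs[OF U])
  have c: "0 \<le> c i" if "i < n" for i
  proof -
    have "0 \<le> (\<Sum>k<n. \<Sum>l<n. cnj (U $$ (k, i)) * A $$ (k, l) * U $$ (l, i))"
      by (rule psd_mat_form[OF assms])
    also have "\<dots> = (mat_adjoint U * (A * U)) $$ (i, i)"
      using that dU dA by (simp add: index_mult_sum sum_distrib_left mult.assoc del: index_mult_mat(1))
    also have "\<dots> = c i"
      using that by (simp flip: D)
    finally show ?thesis .
  qed
  define d where "d i = (if i < n then Re (c i) else 0)" for i
  have "mat_diag n c = mat_diag n (\<lambda>i. complex_of_real (d i))"
    using c by (intro eq_matI) (auto simp: d_def less_eq_complex_def complex_eq_iff)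
  moreover have "0 \<le> d i" for i using c[of i] by (auto simp: d_def less_eq_complex_def)
  ultimately show ?thesis using that[of U d] U A by simp
qed

section \<open>Traces of real powers\<close>

lemma trace_mult_commute:
  assumes "dim_col A = dim_row B" "dim_row A = dim_col B"
  shows "mat_trace (A * B) = mat_trace (B * A)"
proof -
  have "mat_trace (A * B) = (\<Sum>i<dim_row A. \<Sum>k<dim_row B. A $$ (i, k) * B $$ (k, i))"
    using assms by (simp add: mat_trace_def index_mult_sum del: index_mult_mat(1))
  also have "\<dots> = (\<Sum>k<dim_row B. \<Sum>i<dim_row A. A $$ (i, k) * B $$ (k, i))"
    by (rule sum.swap)
  also have "\<dots> = mat_trace (B * A)"
    using assms by (simp add: mat_trace_def index_mult_sum mult.commute del: index_mult_mat(1))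
  finally show ?thesis .
qed

lemma trace_add:
  "dim_row A = dim_row B \<Longrightarrow> dim_row B = dim_col B \<Longrightarrow> mat_trace (A + B) = mat_trace A + mat_trace B"
  by (simp add: mat_trace_def sum.distrib)

lemma trace_smult: "dim_row A = dim_col A \<Longrightarrow> mat_trace (c \<cdot>\<^sub>m A) = c * mat_trace A"
  by (simp add: mat_trace_def sum_distrib_left)

lemma trace_diag: "mat_trace (mat_diag n f) = (\<Sum>i<n. f i)"
  by (simp add: mat_trace_def)

lemma sum_lessThan_add: "(\<Sum>k<a + b. f k) = (\<Sum>k<a. f k) + (\<Sum>k<b. f (a + k))"
  for f :: "nat \<Rightarrow> 'a::comm_monoid_add"
  by (induction b) (auto simp: add.assoc)

lemma trace_direct_sum:
  "dim_row A = dim_col A \<Longrightarrow> dim_row B = dim_col B \<Longrightarrow> mat_trace (A \<oplus>\<^sub>m B) = mat_trace A + mat_trace B"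
  by (simp add: mat_trace_def sum_lessThan_add)

lemma trace_unitary_conj:
  assumes U: "unitary_mat n U" and "dim_row X = n" "dim_col X = n"
  shows "mat_trace (U * X * mat_adjoint U) = mat_trace X"
proof -
  have "mat_trace (U * X * mat_adjoint U) = mat_trace (mat_adjoint U * (U * X))"
    using assms by (intro trace_mult_commute) (auto simp: unitary_dims)
  then show ?thesis using assms by (simp add: unitary_cancel)
qed

section \<open>Calculus of real powers\<close>

text \<open>Any spectral decomposition computes the power, so the rules below reduce to rules for
  \<open>powr\<close> on eigenvalues.\<close>

lemma psd_powr_spectral:
  "unitary_mat n U \<Longrightarrow> (\<And>i. i < n \<Longrightarrow> 0 \<le> d i) \<Longrightarrow>
   psd_powr (U * mat_diag n (\<lambda>i. complex_of_real (d i)) * mat_adjoint U) s =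
   U * mat_diag n (\<lambda>i. complex_of_real (d i powr s)) * mat_adjoint U"
  by (rule psd_powr_eqI) (auto simp: is_psd_powr_def)

lemma unitary_one: "unitary_mat n (1\<^sub>m n)"
  using adjoint_diag[of n "\<lambda>_. 1"] by (simp add: unitary_mat_def)

lemma psd_powr_diag:
  "(\<And>i. i < n \<Longrightarrow> 0 \<le> d i) \<Longrightarrow> psd_powr (mat_diag n (\<lambda>i. complex_of_real (d i))) s =
   mat_diag n (\<lambda>i. complex_of_real (d i powr s))"
  using psd_powr_spectral[OF unitary_one, of n d s] adjoint_diag[of n "\<lambda>_. 1"] by simp

lemma psd_powr_dims:
  assumes "psd_mat n A"
  shows "dim_row (psd_powr A s) = n" "dim_col (psd_powr A s) = n"
proof -
  obtain U d where U: "unitary_mat n U" and d: "\<And>i. 0 \<le> d i"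
    and A: "A = U * mat_diag n (\<lambda>i. complex_of_real (d i)) * mat_adjoint U"
    using psd_spectral[OF assms] by blast
  show "dim_row (psd_powr A s) = n" "dim_col (psd_powr A s) = n"
    unfolding A psd_powr_spectral[OF U d] using unitary_dims[OF U] by auto
qed

lemma adjoint_psd_powr:
  assumes "psd_mat n A"
  shows "mat_adjoint (psd_powr A s) = psd_powr A s"
proof -
  obtain U d where U: "unitary_mat n U" and d: "\<And>i. 0 \<le> d i"
    and A: "A = U * mat_diag n (\<lambda>i. complex_of_real (d i)) * mat_adjoint U"
    using psd_spectral[OF assms] by blast
  show ?thesis
    unfolding A psd_powr_spectral[OF U d] using unitary_dims[OF U] by (simp add: adjoint_mult mult_assoc_dim)
qed

text \<open>The exponents may have any sign. If they add up to 0, the product is the support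
  projection, in line with \<open>0 powr 0 = 0\<close>.\<close>

lemma psd_powr_mult:
  assumes "psd_mat n A"
  shows "psd_powr A s * psd_powr A t = psd_powr A (s + t)"
proof -
  obtain U d where U: "unitary_mat n U" and d: "\<And>i. 0 \<le> d i"
    and A: "A = U * mat_diag n (\<lambda>i. complex_of_real (d i)) * mat_adjoint U"
    using psd_spectral[OF assms] by blast
  have "mat_diag n (\<lambda>i. complex_of_real (d i powr s)) * (mat_diag n (\<lambda>i. complex_of_real (d i powr t)) * X) =
      mat_diag n (\<lambda>i. complex_of_real (d i powr (s + t))) * X" if "dim_row X = n" for X
    using that by (simp add: powr_add flip: mult_assoc_dim)
  then show ?thesis
    unfolding A psd_powr_spectral[OF U d] using unitary_dims[OF U]
    by (simp add: mult_assoc_dim unitary_cancel[OF U])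
qed

lemma psd_powr_powr:
  assumes "psd_mat n A"
  shows "psd_powr (psd_powr A s) t = psd_powr A (s * t)"
proof -
  obtain U d where U: "unitary_mat n U" and d: "\<And>i. 0 \<le> d i"
    and A: "A = U * mat_diag n (\<lambda>i. complex_of_real (d i)) * mat_adjoint U"
    using psd_spectral[OF assms] by blast
  show ?thesis
    unfolding A psd_powr_spectral[OF U d] by (subst psd_powr_spectral[OF U]) (auto simp: powr_powr)
qed

lemma psd_powr_one:
  assumes "psd_mat n A"
  shows "psd_powr A 1 = A"
proof -
  obtain U d where U: "unitary_mat n U" and d: "\<And>i. 0 \<le> d i"
    and A: "A = U * mat_diag n (\<lambda>i. complex_of_real (d i)) * mat_adjoint U"
    using psd_spectral[OF assms] by blast
  show ?thesis
    unfolding A psd_powr_spectral[OF U d] using d by simp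
qed

lemma psd_powr_smult:
  assumes "psd_mat n A" "0 \<le> c"
  shows "psd_powr (complex_of_real c \<cdot>\<^sub>m A) s = complex_of_real (c powr s) \<cdot>\<^sub>m psd_powr A s"
proof -
  obtain U d where U: "unitary_mat n U" and d: "\<And>i. 0 \<le> d i"
    and A: "A = U * mat_diag n (\<lambda>i. complex_of_real (d i)) * mat_adjoint U"
    using psd_spectral[OF assms(1)] by blast
  note dU = unitary_dims[OF U]
  have sm: "complex_of_real k \<cdot>\<^sub>m (U * mat_diag n (\<lambda>i. complex_of_real (e i)) * mat_adjoint U) =
      U * mat_diag n (\<lambda>i. complex_of_real (k * e i)) * mat_adjoint U" for k and e :: "nat \<Rightarrow> real"
  proof -
    have "mat_diag n (\<lambda>i. complex_of_real (k * e i)) = complex_of_real k \<cdot>\<^sub>m mat_diag n (\<lambda>i. complex_of_real (e i))"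
      by (rule eq_matI) auto
    then show ?thesis using dU by (simp only: mult_smult_dim smult_mult_dim dim_mat_diag index_mult_mat dim_adjoint)
  qed
  show ?thesis
    unfolding A psd_powr_spectral[OF U d] sm
    using d assms(2) by (subst psd_powr_spectral[OF U]) (auto simp: powr_mult)
qed

text \<open>Tensor products of eigenvectors are eigenvectors, and \<open>powr\<close> is
  multiplicative on the products of eigenvalues.\<close>

lemma psd_powr_kron:
  assumes "psd_mat n A" "psd_mat m B"
  shows "psd_powr (A \<otimes>\<^sub>m B) s = psd_powr A s \<otimes>\<^sub>m psd_powr B s"
proof -
  obtain U d where U: "unitary_mat n U" and d: "\<And>i. 0 \<le> d i"
    and A: "A = U * mat_diag n (\<lambda>i. complex_of_real (d i)) * mat_adjoint U"
    using psd_spectral[OF assms(1)] by blast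
  obtain V e where V: "unitary_mat m V" and e: "\<And>i. 0 \<le> e i"
    and B: "B = V * mat_diag m (\<lambda>i. complex_of_real (e i)) * mat_adjoint V"
    using psd_spectral[OF assms(2)] by blast
  note dUV = unitary_dims[OF U] unitary_dims[OF V]
  have AB: "(U * mat_diag n (\<lambda>i. complex_of_real (f i)) * mat_adjoint U) \<otimes>\<^sub>m
      (V * mat_diag m (\<lambda>i. complex_of_real (g i)) * mat_adjoint V) =
      (U \<otimes>\<^sub>m V) * mat_diag (n * m) (\<lambda>i. complex_of_real (f (i div m) * g (i mod m))) * mat_adjoint (U \<otimes>\<^sub>m V)"
    for f g :: "nat \<Rightarrow> real"
    using dUV kron_diag[of n "\<lambda>i. complex_of_real (f i)" m "\<lambda>i. complex_of_real (g i)", symmetric]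
    by (simp add: adjoint_kron kron_mult)
  show ?thesis
    unfolding A B psd_powr_spectral[OF U d] psd_powr_spectral[OF V e] AB
    using d e by (subst psd_powr_spectral[OF unitary_kron[OF U V]]) (auto simp: powr_mult)
qed

lemma psd_powr_direct_sum:
  assumes "psd_mat n A" "psd_mat m B"
  shows "psd_powr (A \<oplus>\<^sub>m B) s = psd_powr A s \<oplus>\<^sub>m psd_powr B s"
proof -
  obtain U d where U: "unitary_mat n U" and d: "\<And>i. 0 \<le> d i"
    and A: "A = U * mat_diag n (\<lambda>i. complex_of_real (d i)) * mat_adjoint U"
    using psd_spectral[OF assms(1)] by blast
  obtain V e where V: "unitary_mat m V" and e: "\<And>i. 0 \<le> e i"
    and B: "B = V * mat_diag m (\<lambda>i. complex_of_real (e i)) * mat_adjoint V"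
    using psd_spectral[OF assms(2)] by blast
  note dUV = unitary_dims[OF U] unitary_dims[OF V]
  have AB: "(U * mat_diag n (\<lambda>i. complex_of_real (f i)) * mat_adjoint U) \<oplus>\<^sub>m
      (V * mat_diag m (\<lambda>i. complex_of_real (g i)) * mat_adjoint V) =
      (U \<oplus>\<^sub>m V) * mat_diag (n + m) (\<lambda>i. complex_of_real (if i < n then f i else g (i - n))) * mat_adjoint (U \<oplus>\<^sub>m V)"
    for f g :: "nat \<Rightarrow> real"
    using dUV direct_sum_diag[of n "\<lambda>i. complex_of_real (f i)" m "\<lambda>i. complex_of_real (g i)", symmetric]
    by (simp add: adjoint_direct_sum direct_sum_mult if_distrib[of complex_of_real])
  show ?thesis
    unfolding A B psd_powr_spectral[OF U d] psd_powr_spectral[OF V e] AB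
    using d e by (subst psd_powr_spectral[OF unitary_direct_sum[OF U V]])
      (auto simp: if_distrib[of "\<lambda>x. x powr s"])
qed

section \<open>Traces of powers and Gram matrices\<close>

definition trace_powr :: "complex mat \<Rightarrow> real \<Rightarrow> real" where
  "trace_powr A s = Re (mat_trace (psd_powr A s))"

lemma trace_powr_spectral:
  "unitary_mat n U \<Longrightarrow> (\<And>i. i < n \<Longrightarrow> 0 \<le> d i) \<Longrightarrow>
   trace_powr (U * mat_diag n (\<lambda>i. complex_of_real (d i)) * mat_adjoint U) s = (\<Sum>i<n. d i powr s)"
  by (simp add: trace_powr_def psd_powr_spectral trace_unitary_conj trace_diag)

lemma trace_powr_smult:
  "psd_mat n A \<Longrightarrow> 0 \<le> c \<Longrightarrow> trace_powr (complex_of_real c \<cdot>\<^sub>m A) s = c powr s * trace_powr A s"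
  by (simp add: trace_powr_def psd_powr_smult[of n] trace_smult psd_powr_dims[of n])

lemma trace_powr_direct_sum:
  "psd_mat n A \<Longrightarrow> psd_mat m B \<Longrightarrow> trace_powr (A \<oplus>\<^sub>m B) s = trace_powr A s + trace_powr B s"
  by (simp add: trace_powr_def psd_powr_direct_sum[of n _ m] trace_direct_sum psd_powr_dims[of n] psd_powr_dims[of m])

lemma trace_powr_nonneg:
  assumes "psd_mat n A"
  shows "0 \<le> trace_powr A s"
proof -
  obtain U d where U: "unitary_mat n U" and d: "\<And>i. 0 \<le> d i"
    and A: "A = U * mat_diag n (\<lambda>i. complex_of_real (d i)) * mat_adjoint U"
    using psd_spectral[OF assms] by blast
  show ?thesis
    unfolding A trace_powr_spectral[OF U d] by (simp add: sum_nonneg)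
qed

text \<open>A vanishing sum of nonnegative terms has vanishing terms, and
  \<open>x powr s = 0\<close> forces \<open>x = 0\<close> for every \<open>s\<close>, including
  \<open>s \<le> 0\<close>.\<close>

lemma trace_powr_eq_0:
  assumes "psd_mat n A" "trace_powr A s = 0"
  shows "A = 0\<^sub>m n n"
proof -
  obtain U d where U: "unitary_mat n U" and d: "\<And>i. 0 \<le> d i"
    and A: "A = U * mat_diag n (\<lambda>i. complex_of_real (d i)) * mat_adjoint U"
    using psd_spectral[OF assms(1)] by blast
  have "(\<Sum>i<n. d i powr s) = 0"
    using assms(2) unfolding A trace_powr_spectral[OF U d] .
  then have "d i = 0" if "i < n" for i
    using that by (simp add: sum_nonneg_eq_0_iff)
  then have "mat_diag n (\<lambda>i. complex_of_real (d i)) = 0\<^sub>m n n"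
    by (intro eq_matI) auto
  then show ?thesis
    using unitary_dims[OF U] unfolding A by (intro eq_matI) (auto simp: scalar_prod_def)
qed

lemma trace_powr_zero: "trace_powr (0\<^sub>m n n) s = 0"
proof -
  have "0\<^sub>m n n = mat_diag n (\<lambda>i. complex_of_real 0)"
    by (rule eq_matI) auto
  then show ?thesis
    using psd_powr_diag[of n "\<lambda>_. 0" s] by (simp add: trace_powr_def trace_diag)
qed

text \<open>For \<open>W = V\<^sup>* M U\<close>, where \<open>U\<close> and \<open>V\<close> diagonalize \<open>M\<^sup>* M = U D U\<^sup>*\<close> and \<open>M M\<^sup>* = V E V\<^sup>*\<close>, we have
  \<open>W\<^sup>* W = D\<close>, \<open>W W\<^sup>* = E\<close> and \<open>W D = E W\<close>. Hence \<open>d\<^sub>j\<close> and \<open>e\<^sub>i\<close> agree whenever \<open>W\<^sub>i\<^sub>j\<close> does not vanish, and both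
  traces equal \<open>\<Sum>\<^sub>i\<^sub>j \<bar>W\<^sub>i\<^sub>j\<bar>\<^sup>2 d\<^sub>j\<^bsup>s - 1\<^esup>\<close>.\<close>

lemma trace_powr_gram_commute:
  "trace_powr (M * mat_adjoint M) s = trace_powr (mat_adjoint M * M) s"
proof -
  define n m where "n = dim_row M" and "m = dim_col M"
  have dM: "dim_row M = n" "dim_col M = m" by (simp_all add: n_def m_def)
  obtain U d where U: "unitary_mat m U" and d: "\<And>i. 0 \<le> d i"
    and D: "mat_adjoint M * M = U * mat_diag m (\<lambda>i. complex_of_real (d i)) * mat_adjoint U"
    using psd_spectral[OF psd_mat_gram'[OF dM(2)]] by blast
  obtain V e where V: "unitary_mat n V" and e: "\<And>i. 0 \<le> e i"
    and E: "M * mat_adjoint M = V * mat_diag n (\<lambda>i. complex_of_real (e i)) * mat_adjoint V"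
    using psd_spectral[OF psd_mat_gram[OF dM(1)]] by blast
  note dims = dM unitary_dims[OF U] unitary_dims[OF V]
  let ?D = "mat_diag m (\<lambda>i. complex_of_real (d i))" and ?E = "mat_diag n (\<lambda>i. complex_of_real (e i))"
  define W where "W = mat_adjoint V * (M * U)"
  have dW: "dim_row W = n" "dim_col W = m" using dims by (auto simp: W_def)
  have D': "?D = mat_adjoint U * ((mat_adjoint M * M) * U)"
    using dims by (simp add: D mult_assoc_dim unitary_cancel[OF U] unitary_eqs[OF U])
  have E': "?E = mat_adjoint V * ((M * mat_adjoint M) * V)"
    using dims by (simp add: E mult_assoc_dim unitary_cancel[OF V] unitary_eqs[OF V])
  have WW: "mat_adjoint W * W = ?D"
    unfolding D' using dims by (simp add: W_def adjoint_mult mult_assoc_dim unitary_cancel[OF V])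
  have WW': "W * mat_adjoint W = ?E"
    unfolding E' using dims by (simp add: W_def adjoint_mult mult_assoc_dim unitary_cancel[OF U])
  have comm: "W * ?D = ?E * W"
    using dW by (simp add: WW[symmetric] WW'[symmetric] mult_assoc_dim)
  have eq: "W $$ (i, j) * d j = e i * W $$ (i, j)" if "i < n" "j < m" for i j
  proof -
    have "(W * ?D) $$ (i, j) = (?E * W) $$ (i, j)" by (simp only: comm)
    then show ?thesis using that dW by (simp add: diag_mult_left diag_mult_right del: index_mult_mat(1))
  qed
  have sq: "(cmod (W $$ (i, j)))\<^sup>2 * d j powr (s - 1) = (cmod (W $$ (i, j)))\<^sup>2 * e i powr (s - 1)"
    if "i < n" "j < m" for i j
    using eq[OF that] by (cases "W $$ (i, j) = 0") (auto simp: mult.commute[of _ "W $$ (i, j)"] of_real_eq_iff)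
  have dsum: "d j = (\<Sum>i<n. (cmod (W $$ (i, j)))\<^sup>2)" if "j < m" for j
  proof -
    have "complex_of_real (d j) = (mat_adjoint W * W) $$ (j, j)"
      using that by (simp add: WW)
    also have "\<dots> = complex_of_real (\<Sum>i<n. (cmod (W $$ (i, j)))\<^sup>2)"
      using that dW by (simp add: index_mult_sum complex_norm_square mult.commute del: index_mult_mat(1) of_real_power)
    finally show ?thesis by (simp only: of_real_eq_iff)
  qed
  have esum: "e i = (\<Sum>j<m. (cmod (W $$ (i, j)))\<^sup>2)" if "i < n" for i
  proof -
    have "complex_of_real (e i) = (W * mat_adjoint W) $$ (i, i)"
      using that by (simp add: WW')
    also have "\<dots> = complex_of_real (\<Sum>j<m. (cmod (W $$ (i, j)))\<^sup>2)"
      using that dW by (simp add: index_mult_sum complex_norm_square del: index_mult_mat(1) of_real_power)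
    finally show ?thesis by (simp only: of_real_eq_iff)
  qed
  \<comment> \<open>Splitting off one factor is valid at \<open>x = 0\<close> too, where both sides
    are 0.\<close>
  have pw: "x powr s = x * x powr (s - 1)" if "0 \<le> x" for x :: real
    using that powr_mult_base[of x "s - 1"] by simp
  have "(\<Sum>j<m. d j powr s) = (\<Sum>j<m. \<Sum>i<n. (cmod (W $$ (i, j)))\<^sup>2 * d j powr (s - 1))"
    by (rule sum.cong[OF refl]) (simp add: pw[OF d] dsum[symmetric] flip: sum_distrib_right)
  also have "\<dots> = (\<Sum>j<m. \<Sum>i<n. (cmod (W $$ (i, j)))\<^sup>2 * e i powr (s - 1))"
    by (intro sum.cong refl) (simp add: sq)
  also have "\<dots> = (\<Sum>i<n. \<Sum>j<m. (cmod (W $$ (i, j)))\<^sup>2 * e i powr (s - 1))"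
    by (rule sum.swap)
  also have "\<dots> = (\<Sum>i<n. e i powr s)"
    by (rule sum.cong[OF refl]) (simp add: pw[OF e] esum[symmetric] flip: sum_distrib_right)
  finally show ?thesis
    unfolding D E trace_powr_spectral[OF U d] trace_powr_spectral[OF V e] by simp
qed

text \<open>The block row [A, B]. Its two Gram products are a sum of two products and a 2 by 2 block
  matrix, and \<open>trace_powr_gram_commute\<close> relates the two.\<close>

definition append_cols :: "complex mat \<Rightarrow> complex mat \<Rightarrow> complex mat" where
  "append_cols A B = mat (dim_row A) (dim_col A + dim_col B)
     (\<lambda>(i, j). if j < dim_col A then A $$ (i, j) else B $$ (i, j - dim_col A))"

lemma dim_append_cols [simp]:
  "dim_row (append_cols A B) = dim_row A" "dim_col (append_cols A B) = dim_col A + dim_col B"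
  by (auto simp: append_cols_def)

lemma index_append_cols [simp]:
  "i < dim_row A \<Longrightarrow> j < dim_col A + dim_col B \<Longrightarrow> append_cols A B $$ (i, j) =
    (if j < dim_col A then A $$ (i, j) else B $$ (i, j - dim_col A))"
  by (simp add: append_cols_def)

lemma append_cols_mult_adjoint:
  assumes "dim_row A = dim_row B" "dim_row C = dim_row D" "dim_col A = dim_col C" "dim_col B = dim_col D"
  shows "append_cols A B * mat_adjoint (append_cols C D) = A * mat_adjoint C + B * mat_adjoint D"
  by (rule eq_matI) (use assms in \<open>auto simp: index_mult_sum sum_lessThan_add simp del: index_mult_mat(1)\<close>)

lemma adjoint_append_cols_mult:
  assumes "dim_row A = dim_row B"
  shows "mat_adjoint (append_cols A B) * append_cols A B =
    four_block_mat (mat_adjoint A * A) (mat_adjoint A * B) (mat_adjoint B * A) (mat_adjoint B * B)"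
  by (rule eq_matI) (use assms in \<open>auto simp: index_mult_sum simp del: index_mult_mat(1)\<close>)

text \<open>Conjugating \<open>[[Q, C], [C, Q]]\<close> with a Hadamard matrix makes it block diagonal.\<close>

lemma trace_powr_gram_sum:
  assumes dims: "dim_row A = p" "dim_row B = p" "dim_col A = q" "dim_col B = q"
    and Q: "A * mat_adjoint A = Q" "B * mat_adjoint B = Q"
    and C: "A * mat_adjoint B = C" "B * mat_adjoint A = C"
  shows "trace_powr (mat_adjoint A * A + mat_adjoint B * B) s = trace_powr (Q + C) s + trace_powr (Q - C) s"
proof -
  have dQ: "dim_row Q = p" "dim_col Q = p" "dim_row C = p" "dim_col C = p"
    using dims Q(1) C(1) by auto
  define c where "c = complex_of_real (1 / sqrt 2)"
  have c: "c * c = 1 / 2" "cnj c = c"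
    unfolding c_def by (simp_all flip: of_real_mult)
  \<comment> \<open>The Hadamard rotation of the pair \<open>A\<close>, \<open>B\<close>. Its mixed
    products cancel, since \<open>A\<close> and \<open>B\<close> share \<open>Q\<close> and have
    equal mixed products \<open>C\<close>.\<close>
  define K L where "K = c \<cdot>\<^sub>m (A + B)" and "L = c \<cdot>\<^sub>m (A - B)"
  have dK: "dim_row K = p" "dim_col K = q" "dim_row L = p" "dim_col L = q"
    using dims by (auto simp: K_def L_def)
  have half: "c \<cdot>\<^sub>m (c \<cdot>\<^sub>m X) = (1 / 2) \<cdot>\<^sub>m X" for X
    using c(1) by (intro eq_matI) (auto simp flip: mult.assoc)
  have cc: "c * (c * x) = x / 2" for x
    using c(1) by (simp flip: mult.assoc)
  note ms = adjoint_smult adjoint_add adjoint_minus mult_smult_dim smult_mult_dim c(2) half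
    add_mult_dim mult_add_dim minus_mult_dim mult_minus_dim
  have KK: "K * mat_adjoint K = Q + C" "L * mat_adjoint L = Q - C"
    using dims by (simp_all add: K_def L_def ms Q C) (use dQ in \<open>auto intro!: eq_matI simp: algebra_simps cc\<close>)
  have KL: "K * mat_adjoint L = 0\<^sub>m p p" "L * mat_adjoint K = 0\<^sub>m p p"
    using dims by (simp_all add: K_def L_def ms Q C) (use dQ in \<open>auto intro!: eq_matI simp: algebra_simps cc\<close>)
  have sum: "mat_adjoint K * K + mat_adjoint L * L = mat_adjoint A * A + mat_adjoint B * B"
    using dims by (simp add: K_def L_def ms) (use dims in \<open>auto intro!: eq_matI simp: algebra_simps cc simp del: index_mult_mat(1)\<close>)
  \<comment> \<open>One Gram product of \<open>N\<close> is the sum on the left-hand side, the other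
    is block diagonal with blocks \<open>Q + C\<close> and \<open>Q - C\<close>.\<close>
  define N where "N = append_cols (mat_adjoint K) (mat_adjoint L)"
  have "N * mat_adjoint N = mat_adjoint A * A + mat_adjoint B * B"
    using dK by (simp add: N_def append_cols_mult_adjoint sum)
  moreover have "mat_adjoint N * N = (Q + C) \<oplus>\<^sub>m (Q - C)"
    using dK dQ by (simp add: N_def adjoint_append_cols_mult KK KL direct_sum_def)
  moreover have "psd_mat p (Q + C)" "psd_mat p (Q - C)"
    using psd_mat_gram[OF dK(1)] psd_mat_gram[OF dK(3)] by (simp_all add: KK)
  ultimately show ?thesis
    using trace_powr_gram_commute[of N s] by (simp add: trace_powr_direct_sum)
qed

text \<open>For X = U D U^* take L = U D^(1/2): the columns of \<open>L\<close> are orthogonal, and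
  their squared lengths are the eigenvalues of \<open>X\<close>.\<close>

lemma psd_factor:
  assumes "psd_mat n X"
  obtains L d where "dim_row L = n" "dim_col L = n" "\<And>i. 0 \<le> d i" "X = L * mat_adjoint L"
    "mat_adjoint L * L = mat_diag n (\<lambda>i. complex_of_real (d i))" "\<And>s. trace_powr X s = (\<Sum>i<n. d i powr s)"
proof -
  obtain U d where U: "unitary_mat n U" and d: "\<And>i. 0 \<le> d i"
    and X: "X = U * mat_diag n (\<lambda>i. complex_of_real (d i)) * mat_adjoint U"
    using psd_spectral[OF assms] by blast
  note dU = unitary_dims[OF U]
  let ?R = "mat_diag n (\<lambda>i. complex_of_real (sqrt (d i)))"
  define L where "L = U * ?R"
  have RR: "?R * ?R = mat_diag n (\<lambda>i. complex_of_real (d i))"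
    using d by (simp flip: of_real_mult)
  have "X = U * (?R * ?R) * mat_adjoint U" unfolding X RR ..
  then have "X = L * mat_adjoint L" using dU by (simp add: L_def adjoint_mult mult_assoc_dim del: mat_diag_diag)
  moreover have "mat_adjoint L * L = mat_diag n (\<lambda>i. complex_of_real (d i))"
    using dU by (simp add: L_def adjoint_mult mult_assoc_dim unitary_cancel[OF U] RR del: mat_diag_diag)
  moreover have "trace_powr X s = (\<Sum>i<n. d i powr s)" for s
    unfolding X by (rule trace_powr_spectral[OF U d])
  ultimately show ?thesis using that[of L d] d dU by (simp add: L_def)
qed

text \<open>With X = L L^* the congruence is the Gram product of \<open>S * L\<close>; tensor
  products are handled the same way below.\<close>

lemma psd_mat_congruence:
  assumes "psd_mat n X" "dim_row S = m" "dim_col S = n"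
  shows "psd_mat m (S * X * mat_adjoint S)"
proof -
  obtain L d where L: "dim_row L = n" "dim_col L = n" "X = L * mat_adjoint L"
    using psd_factor[OF assms(1)] by metis
  then have "S * X * mat_adjoint S = (S * L) * mat_adjoint (S * L)"
    using assms by (simp add: adjoint_mult mult_assoc_dim)
  then show ?thesis using psd_mat_gram[of "S * L" m] assms(2) by simp
qed

lemma psd_mat_kron:
  assumes "psd_mat n X" "psd_mat m Y"
  shows "psd_mat (n * m) (X \<otimes>\<^sub>m Y)"
proof -
  obtain L where L: "dim_row L = n" "dim_col L = n" "X = L * mat_adjoint L"
    using psd_factor[OF assms(1)] by metis
  obtain K where K: "dim_row K = m" "dim_col K = m" "Y = K * mat_adjoint K"
    using psd_factor[OF assms(2)] by metis
  have "X \<otimes>\<^sub>m Y = (L \<otimes>\<^sub>m K) * mat_adjoint (L \<otimes>\<^sub>m K)"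
    using L K by (simp add: adjoint_kron kron_mult)
  then show ?thesis using psd_mat_gram[of "L \<otimes>\<^sub>m K" "n * m"] L K by simp
qed

section \<open>Dual channels\<close>

text \<open>The minus sign in B = [L0, -L1] flips the off-diagonal blocks of the Gram matrix. They
  cancel in the sum, while both Gram matrices share the diagonal \<open>d\<close>, which lists the
  eigenvalues of \<open>X0\<close> followed by those of \<open>X1\<close>.\<close>

lemma dual_factors:
  assumes X: "psd_mat n X0" "psd_mat n X1"
  obtains m A B d where "dim_row A = n" "dim_row B = n" "dim_col A = m" "dim_col B = m" "\<And>i. 0 \<le> d i"
    "A * mat_adjoint A = X0 + X1" "B * mat_adjoint B = X0 + X1"
    "A * mat_adjoint B = X0 - X1" "B * mat_adjoint A = X0 - X1"
    "mat_adjoint A * A + mat_adjoint B * B = 2 \<cdot>\<^sub>m mat_diag m (\<lambda>i. complex_of_real (d i))"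
    "\<And>i. i < m \<Longrightarrow> (mat_adjoint A * A) $$ (i, i) = complex_of_real (d i)"
    "\<And>i. i < m \<Longrightarrow> (mat_adjoint B * B) $$ (i, i) = complex_of_real (d i)"
    "\<And>s. (\<Sum>i<m. d i powr s) = trace_powr X0 s + trace_powr X1 s"
proof -
  obtain L0 d0 where L0: "dim_row L0 = n" "dim_col L0 = n" "\<And>i. 0 \<le> d0 i" "X0 = L0 * mat_adjoint L0"
    "mat_adjoint L0 * L0 = mat_diag n (\<lambda>i. complex_of_real (d0 i))" "\<And>s. trace_powr X0 s = (\<Sum>i<n. d0 i powr s)"
    using psd_factor[OF X(1)] by blast
  obtain L1 d1 where L1: "dim_row L1 = n" "dim_col L1 = n" "\<And>i. 0 \<le> d1 i" "X1 = L1 * mat_adjoint L1"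
    "mat_adjoint L1 * L1 = mat_diag n (\<lambda>i. complex_of_real (d1 i))" "\<And>s. trace_powr X1 s = (\<Sum>i<n. d1 i powr s)"
    using psd_factor[OF X(2)] by blast
  define A B where "A = append_cols L0 L1" and "B = append_cols L0 ((- 1) \<cdot>\<^sub>m L1)"
  define d where "d i = (if i < n then d0 i else d1 (i - n))" for i
  let ?K = "mat_adjoint L0 * L1" and ?L = "mat_adjoint L1 * L0"
  have AA: "mat_adjoint A * A = four_block_mat (mat_diag n (\<lambda>i. complex_of_real (d0 i))) ?K ?L
      (mat_diag n (\<lambda>i. complex_of_real (d1 i)))"
    using L0 L1 by (simp add: A_def adjoint_append_cols_mult)
  have neg: "(- 1) \<cdot>\<^sub>m ((- 1) \<cdot>\<^sub>m M) = M" for M :: "complex mat"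
    by (rule eq_matI) auto
  have BB: "mat_adjoint B * B = four_block_mat (mat_diag n (\<lambda>i. complex_of_real (d0 i))) ((- 1) \<cdot>\<^sub>m ?K)
      ((- 1) \<cdot>\<^sub>m ?L) (mat_diag n (\<lambda>i. complex_of_real (d1 i)))"
    using L0 L1 by (simp add: B_def adjoint_append_cols_mult adjoint_smult smult_mult_dim mult_smult_dim neg)
  show ?thesis
  proof (rule that[of A B "n + n" d])
    show "mat_adjoint A * A + mat_adjoint B * B = 2 \<cdot>\<^sub>m mat_diag (n + n) (\<lambda>i. complex_of_real (d i))"
      unfolding AA BB using L0 L1
      by (intro eq_matI) (auto simp: d_def simp del: index_mult_mat(1))
    show "(mat_adjoint A * A) $$ (i, i) = complex_of_real (d i)" if "i < n + n" for i
      unfolding AA using that by (auto simp: d_def)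
    show "(mat_adjoint B * B) $$ (i, i) = complex_of_real (d i)" if "i < n + n" for i
      unfolding BB using that by (auto simp: d_def)
    show "(\<Sum>i<n + n. d i powr s) = trace_powr X0 s + trace_powr X1 s" for s
      by (simp add: sum_lessThan_add L0(6) L1(6) d_def)
    have minus: "M + (- 1) \<cdot>\<^sub>m N = M - N" if "dim_row M = n" "dim_col M = n" "dim_row N = n" "dim_col N = n"
      for M N :: "complex mat"
      using that by (intro eq_matI) auto
    show "A * mat_adjoint A = X0 + X1" "B * mat_adjoint B = X0 + X1"
      "A * mat_adjoint B = X0 - X1" "B * mat_adjoint A = X0 - X1"
      using L0(1,2) L1(1,2)
      by (simp_all add: A_def B_def L0(4) L1(4) append_cols_mult_adjoint adjoint_smult smult_mult_dim
          mult_smult_dim neg minus)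
  qed (use L0 L1 in \<open>auto simp: A_def B_def d_def\<close>)
qed

text \<open>A diagonal entry \<open>0\<close> of \<open>M\<^sup>* M\<close> forces a zero column of \<open>M\<close>, and \<open>0 powr 0 = 0\<close>, so that
  \<open>d\<^sub>j powr 0\<close> is the support projection.\<close>

lemma gram_support:
  assumes "dim_col M = m" "\<And>j. j < m \<Longrightarrow> (mat_adjoint M * M) $$ (j, j) = complex_of_real (d j)"
    and "\<And>j. 0 \<le> d j"
  shows "M * mat_diag m (\<lambda>j. complex_of_real (d j powr 0)) = M"
proof (rule eq_matI)
  fix i j assume "i < dim_row M" "j < dim_col M"
  with assms(1) have ij: "i < dim_row M" "j < m" by auto
  have "M $$ (i, j) = 0" if "d j = 0"
  proof -
    have "complex_of_real (\<Sum>k<dim_row M. (cmod (M $$ (k, j)))\<^sup>2) = (mat_adjoint M * M) $$ (j, j)"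
      using ij assms(1) by (simp add: index_mult_sum complex_norm_square mult.commute del: index_mult_mat(1) of_real_power)
    also have "\<dots> = complex_of_real 0" using assms(2)[OF ij(2)] that by simp
    finally have "(\<Sum>k<dim_row M. (cmod (M $$ (k, j)))\<^sup>2) = 0" by (simp only: of_real_eq_iff)
    then show ?thesis using ij(1) by (simp add: sum_nonneg_eq_0_iff)
  qed
  then show "(M * mat_diag m (\<lambda>j. complex_of_real (d j powr 0))) $$ (i, j) = M $$ (i, j)"
    using ij assms(1) by (auto simp: diag_mult_right simp del: index_mult_mat(1))
qed (use assms in auto)

section \<open>Sandwiching by a marginal\<close>

definition sandwich :: "real \<Rightarrow> complex mat \<Rightarrow> complex mat \<Rightarrow> complex mat" where
  "sandwich \<alpha> R X = psd_powr R ((1 - \<alpha>) / (2 * \<alpha>)) * X * psd_powr R ((1 - \<alpha>) / (2 * \<alpha>))"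

lemma psd_sandwich: "psd_mat n R \<Longrightarrow> psd_mat n X \<Longrightarrow> psd_mat n (sandwich \<alpha> R X)"
  using psd_mat_congruence[of n X "psd_powr R ((1 - \<alpha>) / (2 * \<alpha>))" n]
  by (simp add: sandwich_def adjoint_psd_powr psd_powr_dims[of n])

lemma sandwich_add:
  "psd_mat n R \<Longrightarrow> dim_row X = n \<Longrightarrow> dim_col X = n \<Longrightarrow> dim_row Y = n \<Longrightarrow> dim_col Y = n \<Longrightarrow>
   sandwich \<alpha> R (X + Y) = sandwich \<alpha> R X + sandwich \<alpha> R Y"
  by (simp add: sandwich_def psd_powr_dims[of n] add_mult_dim mult_add_dim)

lemma sandwich_kron:
  assumes "psd_mat n R" "psd_mat m T" "dim_row X = n" "dim_col X = n" "dim_row Y = m" "dim_col Y = m"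
  shows "sandwich \<alpha> (R \<otimes>\<^sub>m T) (X \<otimes>\<^sub>m Y) = sandwich \<alpha> R X \<otimes>\<^sub>m sandwich \<alpha> T Y"
  using assms by (simp add: sandwich_def psd_powr_kron[OF assms(1,2)] kron_mult psd_powr_dims[OF assms(1)] psd_powr_dims[OF assms(2)])

text \<open>The three exponents add up to 1 / \<alpha>, so the outer power \<alpha> gives back
  \<open>R\<close>.\<close>

lemma trace_powr_sandwich_self:
  assumes "psd_mat n R" "0 < \<alpha>"
  shows "trace_powr (sandwich \<alpha> R R) \<alpha> = Re (mat_trace R)"
proof -
  have "sandwich \<alpha> R R = psd_powr R ((1 - \<alpha>) / (2 * \<alpha>)) * psd_powr R 1 * psd_powr R ((1 - \<alpha>) / (2 * \<alpha>))"
    by (simp add: sandwich_def psd_powr_one[OF assms(1)])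
  also have "\<dots> = psd_powr R ((1 - \<alpha>) / (2 * \<alpha>) + 1 + (1 - \<alpha>) / (2 * \<alpha>))"
    by (simp only: psd_powr_mult[OF assms(1)])
  also have "(1 - \<alpha>) / (2 * \<alpha>) + 1 + (1 - \<alpha>) / (2 * \<alpha>) = 1 / \<alpha>"
    using assms(2) by (simp add: field_simps)
  finally show ?thesis
    using assms(2) by (simp add: trace_powr_def psd_powr_powr[OF assms(1)] psd_powr_one[OF assms(1)])
qed

section \<open>Classical registers as block matrices\<close>

lemma div_less_twice: "i < n + n \<Longrightarrow> i div n = (if i < n then 0 else 1)" for i n :: nat
  by (auto simp: div_nat_eqI)

lemma mod_less_twice: "i < n + n \<Longrightarrow> i mod n = (if i < n then i else i - n)" for i n :: nat
  by (auto simp: mod_if)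

lemma one_kron: "dim_row S = n \<Longrightarrow> dim_col S = n \<Longrightarrow> 1\<^sub>m 2 \<otimes>\<^sub>m S = S \<oplus>\<^sub>m S"
  by (rule eq_matI) (auto simp: div_less_twice mod_less_twice mult_2)

lemma dim_bit_proj [simp]: "dim_row (bit_proj x) = 2" "dim_col (bit_proj x) = 2"
  by (simp_all add: bit_proj_def)

lemma trace_bit_proj: "mat_trace (bit_proj x) = 1"
  by (simp add: bit_proj_def trace_diag numeral_2_eq_2)

lemma bit_proj_kron:
  assumes "dim_row C = n" "dim_col C = n"
  shows "bit_proj x \<otimes>\<^sub>m C = (if x then 0\<^sub>m n n \<oplus>\<^sub>m C else C \<oplus>\<^sub>m 0\<^sub>m n n)"
  by (rule eq_matI)
    (use assms in \<open>auto simp: bit_proj_def div_less_twice mod_less_twice mult_2 split: if_splits\<close>)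

lemma partial_trace_direct_sum:
  assumes "dim_row A = n" "dim_col A = n" "dim_row B = n" "dim_col B = n"
  shows "partial_trace 1 2 n (A \<oplus>\<^sub>m B) = A + B"
  by (rule eq_matI) (use assms in \<open>auto simp: partial_trace_def numeral_2_eq_2\<close>)

text \<open>Each of the digits \<open>i div b\<close>, \<open>k\<close>, \<open>i mod b\<close> is
  below its radix, so the entries read by \<open>partial_trace\<close> lie inside the
  matrix.\<close>

lemma partial_trace_index_less:
  fixes i k a b c :: nat
  assumes "i < a * b" "k < c"
  shows "(i div b * c + k) * b + i mod b < a * (c * b)"
proof -
  note b = mod_less_of_mult[OF assms(1)] less_mult_imp_div_less[OF assms(1)]
  have "(i div b * c + k) * b + i mod b < Suc (i div b * c + k) * b" using b by simp
  also have "\<dots> \<le> (Suc (i div b) * c) * b" using assms(2) by (intro mult_le_mono1) simp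
  also have "\<dots> \<le> (a * c) * b" using b by (intro mult_le_mono1) simp
  finally show ?thesis by (simp add: mult.assoc)
qed

lemma partial_trace_add:
  assumes "dim_row N = a * (c * b)" "dim_col N = a * (c * b)"
  shows "partial_trace a c b (M + N) = partial_trace a c b M + partial_trace a c b N"
  by (rule eq_matI)
    (use assms in \<open>auto simp: partial_trace_def partial_trace_index_less sum.distrib\<close>)

lemma partial_trace_kron:
  assumes "dim_row P = a" "dim_col P = a" "dim_row Q = c" "dim_col Q = c" "dim_row C = b" "dim_col C = b"
  shows "partial_trace a c b (P \<otimes>\<^sub>m (Q \<otimes>\<^sub>m C)) = mat_trace Q \<cdot>\<^sub>m (P \<otimes>\<^sub>m C)"
proof (rule eq_matI)
  fix i j assume "i < dim_row (mat_trace Q \<cdot>\<^sub>m (P \<otimes>\<^sub>m C))" "j < dim_col (mat_trace Q \<cdot>\<^sub>m (P \<otimes>\<^sub>m C))"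
  with assms have ij: "i < a * b" "j < a * b" by auto
  have idx: "((l div b * c + k) * b + l mod b) div (c * b) = l div b"
    "((l div b * c + k) * b + l mod b) mod (c * b) div b = k"
    "((l div b * c + k) * b + l mod b) mod (c * b) mod b = l mod b"
    "((l div b * c + k) * b + l mod b) mod (c * b) < c * b" if "k < c" "l < a * b" for k l
  proof -
    have lb: "l mod b < b" "0 < b" using that by (cases "b = 0"; simp)+
    have "k * b + l mod b < Suc k * b" using lb by simp
    also have "\<dots> \<le> c * b" using that by (intro mult_le_mono1) simp
    finally have lt: "k * b + l mod b < c * b" .
    \<comment> \<open>Regrouping isolates the leading digit; the rest is below \<open>c * b\<close>,
      so division and remainder separate them.\<close>
    have eq: "(l div b * c + k) * b + l mod b = (k * b + l mod b) + l div b * (c * b)"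
      by (simp add: algebra_simps)
    have m: "((l div b * c + k) * b + l mod b) mod (c * b) = k * b + l mod b"
      unfolding eq using lt by (simp only: mod_mult_self1 mod_less)
    show "((l div b * c + k) * b + l mod b) mod (c * b) div b = k"
      "((l div b * c + k) * b + l mod b) mod (c * b) mod b = l mod b"
      "((l div b * c + k) * b + l mod b) mod (c * b) < c * b"
      unfolding m using lb lt by simp_all
    show "((l div b * c + k) * b + l mod b) div (c * b) = l div b"
      unfolding eq using lt lb that by (subst div_mult_self1) auto
  qed
  have "partial_trace a c b (P \<otimes>\<^sub>m (Q \<otimes>\<^sub>m C)) $$ (i, j) =
     (\<Sum>k<c. P $$ (i div b, j div b) * (Q $$ (k, k) * C $$ (i mod b, j mod b)))"
    using ij assms by (auto simp: partial_trace_def partial_trace_index_less idx intro!: sum.cong)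
  also have "\<dots> = (mat_trace Q \<cdot>\<^sub>m (P \<otimes>\<^sub>m C)) $$ (i, j)"
    using ij assms by (simp add: mat_trace_def sum_distrib_left sum_distrib_right mult_ac)
  finally show "partial_trace a c b (P \<otimes>\<^sub>m (Q \<otimes>\<^sub>m C)) $$ (i, j) = (mat_trace Q \<cdot>\<^sub>m (P \<otimes>\<^sub>m C)) $$ (i, j)" .
qed (use assms in \<open>auto simp: partial_trace_def\<close>)

text \<open>The marginal of a classical-quantum state is the sum of its blocks, and the sandwiching
  operator is the same on both blocks, so the trace splits.\<close>

lemma sandwiched_H_down_direct_sum:
  assumes A: "psd_mat n A" and B: "psd_mat n B"
  shows "sandwiched_H_down \<alpha> 2 n (A \<oplus>\<^sub>m B) =
    1 / (1 - \<alpha>) * ln (trace_powr (sandwich \<alpha> (A + B) A) \<alpha> + trace_powr (sandwich \<alpha> (A + B) B) \<alpha>)"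
proof -
  note d = psd_dims[OF A] psd_dims[OF B]
  have R: "psd_mat n (A + B)" by (rule psd_mat_add[OF A B])
  let ?S = "psd_powr (A + B) ((1 - \<alpha>) / (2 * \<alpha>))"
  note dS = psd_powr_dims[OF R]
  have "(?S \<oplus>\<^sub>m ?S) * (A \<oplus>\<^sub>m B) * (?S \<oplus>\<^sub>m ?S) = sandwich \<alpha> (A + B) A \<oplus>\<^sub>m sandwich \<alpha> (A + B) B"
    by (simp add: direct_sum_mult d dS sandwich_def)
  then show ?thesis
    unfolding sandwiched_H_down_def partial_trace_direct_sum[OF d] one_kron[OF dS] Let_def
    using trace_powr_direct_sum[OF psd_sandwich[OF R A] psd_sandwich[OF R B]]
    by (simp add: trace_powr_def)
qed

section \<open>Entropies of channels and box products\<close>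

text \<open>The marginal on the output system of the state with uniform input.\<close>

definition mean_output :: "bcq \<Rightarrow> complex mat" where
  "mean_output W = (1 / 2) \<cdot>\<^sub>m W False + (1 / 2) \<cdot>\<^sub>m W True"

text \<open>The matrix called \<open>X\<^sub>x\<close> in the overview. The input probability 1/2 is
  included, so the two matrices add up to the sandwiched marginal.\<close>

definition sandwiched_output :: "real \<Rightarrow> bcq \<Rightarrow> bool \<Rightarrow> complex mat" where
  "sandwiched_output \<alpha> W x = sandwich \<alpha> (mean_output W) ((1 / 2) \<cdot>\<^sub>m W x)"

lemma bcq_channel_psd: "bcq_channel W \<Longrightarrow> psd_mat (out_dim W) (W x)"
  by (simp add: bcq_channel_def quantum_state_def)

lemma bcq_channel_half_psd: "bcq_channel W \<Longrightarrow> psd_mat (out_dim W) ((1 / 2) \<cdot>\<^sub>m W x)"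
  using psd_mat_smult[OF bcq_channel_psd, of W "1 / 2" x] by simp

lemma mean_output_psd: "bcq_channel W \<Longrightarrow> psd_mat (out_dim W) (mean_output W)"
  unfolding mean_output_def by (intro psd_mat_add bcq_channel_half_psd)

lemma sandwiched_output_psd: "bcq_channel W \<Longrightarrow> psd_mat (out_dim W) (sandwiched_output \<alpha> W x)"
  unfolding sandwiched_output_def by (intro psd_sandwich mean_output_psd bcq_channel_half_psd)

text \<open>The sum is the marginal sandwiched by itself, so the value is the trace of a state. This
  normalization determines the entropy of the dual channel.\<close>

lemma trace_powr_sandwiched_output_sum:
  assumes W: "bcq_channel W" and "0 < \<alpha>"
  shows "trace_powr (sandwiched_output \<alpha> W False + sandwiched_output \<alpha> W True) \<alpha> = 1"
proof -
  note d = psd_dims[OF bcq_channel_psd[OF W]]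
  have "sandwiched_output \<alpha> W False + sandwiched_output \<alpha> W True = sandwich \<alpha> (mean_output W) (mean_output W)"
    using sandwich_add[OF mean_output_psd[OF W], of "(1 / 2) \<cdot>\<^sub>m W False" "(1 / 2) \<cdot>\<^sub>m W True"]
    by (simp add: sandwiched_output_def d flip: mean_output_def)
  moreover have "mat_trace (mean_output W) = 1"
    using W by (simp add: mean_output_def trace_add trace_smult d bcq_channel_def quantum_state_def)
  ultimately show ?thesis using trace_powr_sandwich_self[OF mean_output_psd[OF W] assms(2)] by simp
qed

lemma channel_H_eq:
  assumes W: "bcq_channel W"
  shows "channel_H \<alpha> W = 1 / (1 - \<alpha>) *
    ln (trace_powr (sandwiched_output \<alpha> W False) \<alpha> + trace_powr (sandwiched_output \<alpha> W True) \<alpha>)"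
proof -
  note d = psd_dims[OF bcq_channel_psd[OF W]]
  have "bcq_state W = (1 / 2) \<cdot>\<^sub>m W False \<oplus>\<^sub>m (1 / 2) \<cdot>\<^sub>m W True"
    unfolding bcq_state_def
    by (rule eq_matI) (auto simp: bit_proj_kron[where n = "out_dim W"] d)
  then show ?thesis
    using sandwiched_H_down_direct_sum[OF bcq_channel_half_psd[OF W] bcq_channel_half_psd[OF W]]
    by (simp add: channel_H_def sandwiched_output_def mean_output_def)
qed

text \<open>Once the second input is traced out, the bit \<open>x1 \<noteq> x2\<close> selects a
  block: equal inputs form the first one, different inputs the second. The marginal is a tensor
  product, so sandwiching acts on each factor separately.\<close>

lemma box_H_eq:
  fixes \<alpha> :: real and W1 W2 :: bcq
  assumes W1: "bcq_channel W1" and W2: "bcq_channel W2"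
  defines "X \<equiv> sandwiched_output \<alpha> W1" and "Y \<equiv> sandwiched_output \<alpha> W2"
  shows "box_H \<alpha> W1 W2 = 1 / (1 - \<alpha>) *
    ln (trace_powr (X False \<otimes>\<^sub>m Y False + X True \<otimes>\<^sub>m Y True) \<alpha> +
        trace_powr (X False \<otimes>\<^sub>m Y True + X True \<otimes>\<^sub>m Y False) \<alpha>)"
proof -
  note d = psd_dims[OF bcq_channel_psd[OF W1]] psd_dims[OF bcq_channel_psd[OF W2]]
  let ?b = "out_dim W1 * out_dim W2"
  define C where "C x y = ((1 / 2) \<cdot>\<^sub>m W1 x) \<otimes>\<^sub>m ((1 / 2) \<cdot>\<^sub>m W2 y)" for x y
  have dC: "dim_row (C x y) = ?b" "dim_col (C x y) = ?b" for x y
    by (simp_all add: C_def d)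
  have C: "psd_mat ?b (C x y)" for x y
    unfolding C_def by (intro psd_mat_kron bcq_channel_half_psd W1 W2)
  have t: "(1 / 4) \<cdot>\<^sub>m (P \<otimes>\<^sub>m Q \<otimes>\<^sub>m W1 x \<otimes>\<^sub>m W2 y) = P \<otimes>\<^sub>m (Q \<otimes>\<^sub>m C x y)" for P Q x y
  proof -
    have "(1 / 4) \<cdot>\<^sub>m (W1 x \<otimes>\<^sub>m W2 y) = C x y"
      unfolding C_def by (rule eq_matI) (auto simp: less_mult_imp_div_less mod_less_of_mult)
    moreover have "(1 / 4) \<cdot>\<^sub>m (P \<otimes>\<^sub>m Q \<otimes>\<^sub>m W1 x \<otimes>\<^sub>m W2 y) = P \<otimes>\<^sub>m (Q \<otimes>\<^sub>m ((1 / 4) \<cdot>\<^sub>m (W1 x \<otimes>\<^sub>m W2 y)))"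
      by (simp only: kron_assoc kron_smult_right)
    ultimately show ?thesis by simp
  qed
  let ?A = "C False False + C True True" and ?B = "C False True + C True False"
  have one: "1 \<cdot>\<^sub>m M = M" for M :: "complex mat" by (rule eq_matI) auto
  have "partial_trace 2 2 ?b (box_state W1 W2) =
      bit_proj False \<otimes>\<^sub>m C False False + bit_proj True \<otimes>\<^sub>m C False True +
      bit_proj True \<otimes>\<^sub>m C True False + bit_proj False \<otimes>\<^sub>m C True True"
    unfolding box_state_def Let_def t
    by (simp add: partial_trace_add partial_trace_kron dC trace_bit_proj one)
  also have "\<dots> = ?A \<oplus>\<^sub>m ?B"
    unfolding bit_proj_kron[OF dC] by (rule eq_matI) (auto simp: dC)
  finally have "partial_trace 2 2 ?b (box_state W1 W2) = ?A \<oplus>\<^sub>m ?B" .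
  moreover have "psd_mat ?b ?A" "psd_mat ?b ?B"
    by (intro psd_mat_add C)+
  ultimately have H: "box_H \<alpha> W1 W2 = 1 / (1 - \<alpha>) *
      ln (trace_powr (sandwich \<alpha> (?A + ?B) ?A) \<alpha> + trace_powr (sandwich \<alpha> (?A + ?B) ?B) \<alpha>)"
    by (simp add: box_H_def sandwiched_H_down_direct_sum)
  have R: "?A + ?B = mean_output W1 \<otimes>\<^sub>m mean_output W2"
    by (rule eq_matI) (auto simp: mean_output_def C_def d less_mult_imp_div_less mod_less_of_mult algebra_simps)
  have Rpsd: "psd_mat ?b (mean_output W1 \<otimes>\<^sub>m mean_output W2)"
    by (intro psd_mat_kron mean_output_psd W1 W2)
  have "sandwich \<alpha> (mean_output W1 \<otimes>\<^sub>m mean_output W2) (C x y) = X x \<otimes>\<^sub>m Y y" for x y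
    unfolding C_def X_def Y_def sandwiched_output_def
    by (rule sandwich_kron) (auto simp: d mean_output_psd W1 W2)
  then show ?thesis
    unfolding H R by (simp add: sandwich_add[OF Rpsd] dC)
qed

text \<open>If both traces vanished, both outputs would be 0, although the power of their sum has
  trace 1. Positivity allows the logarithms to be split later.\<close>

lemma sandwiched_output_trace_pos:
  assumes W: "bcq_channel W" and "0 < \<alpha>"
  shows "0 < trace_powr (sandwiched_output \<alpha> W False) \<alpha> + trace_powr (sandwiched_output \<alpha> W True) \<alpha>"
proof (rule ccontr)
  note X = sandwiched_output_psd[OF W]
  assume "\<not> ?thesis"
  then have "trace_powr (sandwiched_output \<alpha> W x) \<alpha> = 0" for x
    using trace_powr_nonneg[OF X, of \<alpha> False \<alpha>] trace_powr_nonneg[OF X, of \<alpha> True \<alpha>] by (cases x) auto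
  then have "sandwiched_output \<alpha> W x = 0\<^sub>m (out_dim W) (out_dim W)" for x
    by (rule trace_powr_eq_0[OF X])
  then show False
    using trace_powr_sandwiched_output_sum[OF assms] trace_powr_zero[of "out_dim W" \<alpha>] by simp
qed

lemma Im_trace_psd_powr:
  assumes "psd_mat n A"
  shows "Im (mat_trace (psd_powr A s)) = 0"
proof -
  obtain U d where U: "unitary_mat n U" and d: "\<And>i. 0 \<le> d i"
    and A: "A = U * mat_diag n (\<lambda>i. complex_of_real (d i)) * mat_adjoint U"
    using psd_spectral[OF assms] by blast
  show ?thesis
    unfolding A psd_powr_spectral[OF U d] by (simp add: trace_unitary_conj[OF U] trace_diag)
qed

text \<open>The two block matrices add up to \<open>?P \<otimes>\<^sub>m ?Q\<close>. Were both 0,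
  the trace of its power would be 0, but that trace is a product of two factors equal to 1.\<close>

lemma box_trace_pos:
  fixes \<alpha> :: real and W1 W2 :: bcq
  assumes W1: "bcq_channel W1" and W2: "bcq_channel W2" and \<alpha>: "0 < \<alpha>"
  defines "X \<equiv> sandwiched_output \<alpha> W1" and "Y \<equiv> sandwiched_output \<alpha> W2"
  shows "0 < trace_powr (X False \<otimes>\<^sub>m Y False + X True \<otimes>\<^sub>m Y True) \<alpha> +
      trace_powr (X False \<otimes>\<^sub>m Y True + X True \<otimes>\<^sub>m Y False) \<alpha>"
    (is "0 < trace_powr ?A \<alpha> + trace_powr ?B \<alpha>")
proof (rule ccontr)
  let ?n = "out_dim W1" and ?m = "out_dim W2"
  have X: "psd_mat ?n (X x)" and Y: "psd_mat ?m (Y x)" for x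
    unfolding X_def Y_def by (intro sandwiched_output_psd W1 W2)+
  note d = psd_dims[OF X] psd_dims[OF Y]
  have AB: "psd_mat (?n * ?m) ?A" "psd_mat (?n * ?m) ?B"
    by (intro psd_mat_add psd_mat_kron X Y)+
  let ?P = "X False + X True" and ?Q = "Y False + Y True"
  have P: "psd_mat ?n ?P" and Q: "psd_mat ?m ?Q" by (intro psd_mat_add X Y)+
  assume "\<not> ?thesis"
  then have "trace_powr ?A \<alpha> = 0" "trace_powr ?B \<alpha> = 0"
    using trace_powr_nonneg[OF AB(1), of \<alpha>] trace_powr_nonneg[OF AB(2), of \<alpha>] by auto
  then have 0: "?A = 0\<^sub>m (?n * ?m) (?n * ?m)" "?B = 0\<^sub>m (?n * ?m) (?n * ?m)"
    using trace_powr_eq_0[OF AB(1)] trace_powr_eq_0[OF AB(2)] by blast+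
  have "?P \<otimes>\<^sub>m ?Q = ?A + ?B"
    by (rule eq_matI) (auto simp: d less_mult_imp_div_less mod_less_of_mult algebra_simps)
  then have "trace_powr (?P \<otimes>\<^sub>m ?Q) \<alpha> = 0"
    by (simp add: 0 trace_powr_zero)
  moreover have "mat_trace (psd_powr (?P \<otimes>\<^sub>m ?Q) \<alpha>) = mat_trace (psd_powr ?P \<alpha>) * mat_trace (psd_powr ?Q \<alpha>)"
    by (simp add: psd_powr_kron[OF P Q] trace_kron psd_powr_dims[OF P] psd_powr_dims[OF Q])
  moreover have "trace_powr ?P \<alpha> = 1" "trace_powr ?Q \<alpha> = 1"
    unfolding X_def Y_def by (intro trace_powr_sandwiched_output_sum W1 W2 \<alpha>)+
  \<comment> \<open>\<open>trace_powr\<close> takes real parts, and the real part of a product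
    splits because this factor is real.\<close>
  moreover have "Im (mat_trace (psd_powr ?P \<alpha>)) = 0"
    by (rule Im_trace_psd_powr[OF P])
  ultimately show False by (simp add: trace_powr_def)
qed

section \<open>Construction of the dual channel\<close>

text \<open>\<open>M\<close> holds the factors \<open>A\<close> and \<open>B\<close> of the
  overview. Writing the output as a Gram product makes it positive semidefinite at sight; the scalar
  gives it trace 1.\<close>

definition dual_channel :: "real \<Rightarrow> (bool \<Rightarrow> complex mat) \<Rightarrow> (nat \<Rightarrow> real) \<Rightarrow> nat \<Rightarrow> bcq" where
  "dual_channel \<alpha> M d m x =
     (let E = mat_diag m (\<lambda>i. complex_of_real (d i powr ((\<alpha> - 1) / 2)))
      in complex_of_real (1 / (\<Sum>i<m. d i powr \<alpha>)) \<cdot>\<^sub>m (mat_adjoint (M x * E) * (M x * E)))"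

text \<open>The marginal of \<open>V\<close> is diagonal with entries
  \<open>d i powr \<alpha> / F\<close>. The power of it used for sandwiching therefore cancels the
  weight \<open>E\<close> up to a scalar and the support projection.\<close>

lemma dual_channel:
  fixes \<alpha> :: real and M :: "bool \<Rightarrow> complex mat" and d :: "nat \<Rightarrow> real" and m :: nat
  assumes \<alpha>: "0 < \<alpha>" and M: "\<And>x. dim_col (M x) = m" and d: "\<And>i. 0 \<le> d i"
    and sum: "mat_adjoint (M False) * M False + mat_adjoint (M True) * M True = 2 \<cdot>\<^sub>m mat_diag m (\<lambda>i. complex_of_real (d i))"
    and diag: "\<And>x i. i < m \<Longrightarrow> (mat_adjoint (M x) * M x) $$ (i, i) = complex_of_real (d i)"
    and pos: "0 < (\<Sum>i<m. d i powr \<alpha>)"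
  defines "F \<equiv> \<Sum>i<m. d i powr \<alpha>" and "V \<equiv> dual_channel \<alpha> M d m"
  shows "bcq_channel V" "out_dim V = m"
    "sandwiched_output \<alpha> V x = complex_of_real (F powr (- 1 / \<alpha>) / 2) \<cdot>\<^sub>m (mat_adjoint (M x) * M x)"
proof -
  have F: "0 < F" using pos by (simp add: F_def)
  define E where "E = mat_diag m (\<lambda>i. complex_of_real (d i powr ((\<alpha> - 1) / 2)))"
  have E [simp]: "dim_row E = m" "dim_col E = m" "mat_adjoint E = E" by (simp_all add: E_def)
  have V: "V x = complex_of_real (1 / F) \<cdot>\<^sub>m (mat_adjoint (M x * E) * (M x * E))" for x
    by (simp add: V_def dual_channel_def F_def E_def Let_def)
  have dV: "dim_row (V x) = m" "dim_col (V x) = m" for x by (simp_all add: V)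
  show out: "out_dim V = m" by (simp add: out_dim_def dV)
  have V': "V x = complex_of_real (1 / F) \<cdot>\<^sub>m (E * (mat_adjoint (M x) * M x) * E)" for x
    by (simp add: V adjoint_mult mult_assoc_dim M)
  have "mat_trace (V x) = 1" for x
  proof -
    have "(E * (mat_adjoint (M x) * M x) * E) $$ (i, i) = complex_of_real (d i powr \<alpha>)" if "i < m" for i
    proof -
      have "(E * (mat_adjoint (M x) * M x) * E) $$ (i, i) =
          complex_of_real (d i powr ((\<alpha> - 1) / 2)) * complex_of_real (d i) * complex_of_real (d i powr ((\<alpha> - 1) / 2))"
        using that M by (simp add: E_def diag_mult_left diag_mult_right diag del: index_mult_mat(1))
      \<comment> \<open>Writing \<open>d i\<close> as \<open>d i powr 1\<close> lets
        \<open>powr_add\<close> cover the case \<open>d i = 0\<close>.\<close>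
      also have "\<dots> = complex_of_real (d i powr ((\<alpha> - 1) / 2) * (d i powr 1) * d i powr ((\<alpha> - 1) / 2))"
        using d by simp
      also have "d i powr ((\<alpha> - 1) / 2) * (d i powr 1) * d i powr ((\<alpha> - 1) / 2) = d i powr \<alpha>"
        by (simp only: powr_add[symmetric]) (simp add: field_simps)
      finally show ?thesis .
    qed
    then have "mat_trace (E * (mat_adjoint (M x) * M x) * E) = complex_of_real F"
      by (simp add: mat_trace_def F_def M del: index_mult_mat(1))
    then show ?thesis using F by (simp add: V' trace_smult M)
  qed
  moreover have "psd_mat m (V x)" for x
    unfolding V using F by (intro psd_mat_smult psd_mat_gram') auto
  ultimately show "bcq_channel V"
    by (simp add: bcq_channel_def quantum_state_def out)
  define s where "s = (1 - \<alpha>) / (2 * \<alpha>)"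
  \<comment> \<open>The first identity makes the weights cancel, the second collects the powers of
    \<open>F\<close>.\<close>
  have s: "(\<alpha> - 1) / 2 + \<alpha> * s = 0" "- 1 + (- s + - s) = - 1 / \<alpha>"
    using \<alpha> by (simp_all add: s_def field_simps)
  have "mean_output V = complex_of_real (1 / (2 * F)) \<cdot>\<^sub>m
      (E * (mat_adjoint (M False) * M False + mat_adjoint (M True) * M True) * E)"
    by (simp add: mean_output_def V' mult_add_dim add_mult_dim M)
      (rule eq_matI; auto simp: M algebra_simps simp del: index_mult_mat(1))
  also have "\<dots> = mat_diag m (\<lambda>i. complex_of_real (d i powr \<alpha> / F))"
  proof (rule eq_matI)
    fix i j assume "i < dim_row (mat_diag m (\<lambda>i. complex_of_real (d i powr \<alpha> / F)))"
      "j < dim_col (mat_diag m (\<lambda>i. complex_of_real (d i powr \<alpha> / F)))"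
    then have ij: "i < m" "j < m" by auto
    have "d i powr ((\<alpha> - 1) / 2) * (d i powr 1) * d i powr ((\<alpha> - 1) / 2) = d i powr \<alpha>"
      by (simp only: powr_add[symmetric]) (simp add: field_simps)
    then have "d i * (d i powr ((\<alpha> - 1) / 2) * d i powr ((\<alpha> - 1) / 2)) = d i powr \<alpha>"
      using d[of i] by (simp add: mult_ac)
    then have pw: "complex_of_real (d i) * (complex_of_real (d i powr ((\<alpha> - 1) / 2)) * complex_of_real (d i powr ((\<alpha> - 1) / 2))) =
        complex_of_real (d i powr \<alpha>)"
      by (simp only: of_real_mult[symmetric])
    show "(complex_of_real (1 / (2 * F)) \<cdot>\<^sub>m
        (E * (mat_adjoint (M False) * M False + mat_adjoint (M True) * M True) * E)) $$ (i, j) =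
      mat_diag m (\<lambda>i. complex_of_real (d i powr \<alpha> / F)) $$ (i, j)"
      unfolding sum using ij F pw
      by (auto simp: E_def diag_mult_left diag_mult_right mult_ac simp del: index_mult_mat(1))
  qed auto
  finally have mean: "mean_output V = mat_diag m (\<lambda>i. complex_of_real (d i powr \<alpha> / F))" .
  define S where "S = psd_powr (mean_output V) s"
  have S: "S = mat_diag m (\<lambda>i. complex_of_real ((d i powr \<alpha> / F) powr s))"
    unfolding S_def mean using F by (intro psd_powr_diag) simp
  have S' [simp]: "dim_row S = m" "dim_col S = m" "mat_adjoint S = S" by (simp_all add: S)
  have "E * S = complex_of_real (F powr (- s)) \<cdot>\<^sub>m mat_diag m (\<lambda>i. complex_of_real (d i powr 0))"
  proof -
    have "d i powr ((\<alpha> - 1) / 2) * (d i powr \<alpha> / F) powr s = F powr (- s) * d i powr 0" for i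
    proof -
      have "(d i powr \<alpha> / F) powr s = (d i powr \<alpha>) powr s / F powr s"
        by (rule powr_divide)
      also have "\<dots> = d i powr (\<alpha> * s) * F powr (- s)"
        by (simp only: powr_powr powr_minus divide_inverse)
      finally have "d i powr ((\<alpha> - 1) / 2) * (d i powr \<alpha> / F) powr s =
          F powr (- s) * (d i powr ((\<alpha> - 1) / 2) * d i powr (\<alpha> * s))" by (simp only: mult_ac)
      also have "d i powr ((\<alpha> - 1) / 2) * d i powr (\<alpha> * s) = d i powr 0"
        by (simp only: powr_add[symmetric] s)
      finally show ?thesis .
    qed
    then show ?thesis
      unfolding E_def S by (intro eq_matI) (auto simp flip: of_real_mult)
  qed
  \<comment> \<open>By \<open>gram_support\<close> the matrix \<open>M x\<close> absorbs the support
    projection.\<close>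
  then have MES: "M x * (E * S) = complex_of_real (F powr (- s)) \<cdot>\<^sub>m M x"
    using gram_support[OF M diag d, of x] by (simp add: mult_smult_dim M)
  have "sandwiched_output \<alpha> V x = S * ((1 / 2) \<cdot>\<^sub>m V x) * S"
    by (simp add: sandwiched_output_def sandwich_def S_def s_def)
  also have "\<dots> = complex_of_real (1 / (2 * F)) \<cdot>\<^sub>m (S * (mat_adjoint (M x * E) * (M x * E)) * S)"
    unfolding V by (simp add: mult_smult_dim smult_mult_dim M) (rule eq_matI; auto simp: M simp del: index_mult_mat(1))
  also have "S * (mat_adjoint (M x * E) * (M x * E)) * S = mat_adjoint (M x * (E * S)) * (M x * (E * S))"
    by (simp add: adjoint_mult mult_assoc_dim M)
  also have "\<dots> = complex_of_real (F powr (- s) * F powr (- s)) \<cdot>\<^sub>m (mat_adjoint (M x) * M x)"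
    unfolding MES by (simp add: adjoint_smult mult_smult_dim smult_mult_dim M)
      (rule eq_matI; auto simp: M simp del: index_mult_mat(1))
  finally have "sandwiched_output \<alpha> V x = complex_of_real (1 / (2 * F) * (F powr (- s) * F powr (- s))) \<cdot>\<^sub>m (mat_adjoint (M x) * M x)"
    by (simp only:) (rule eq_matI; auto simp: M simp del: index_mult_mat(1))
  moreover have "1 / (2 * F) * (F powr (- s) * F powr (- s)) = F powr (- 1 / \<alpha>) / 2"
  proof -
    have "1 / (2 * F) = F powr (- 1) / 2"
      using F by (simp add: powr_neg_one)
    then have "1 / (2 * F) * (F powr (- s) * F powr (- s)) = (F powr (- 1) * (F powr (- s) * F powr (- s))) / 2"
      by (simp only: times_divide_eq_left)
    also have "F powr (- 1) * (F powr (- s) * F powr (- s)) = F powr (- 1 / \<alpha>)"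
      by (simp only: powr_add[symmetric] s)
    finally show ?thesis .
  qed
  ultimately show "sandwiched_output \<alpha> V x = complex_of_real (F powr (- 1 / \<alpha>) / 2) \<cdot>\<^sub>m (mat_adjoint (M x) * M x)"
    by (simp only:)
qed

lemma dual_channel_exists:
  assumes W: "bcq_channel W" and \<alpha>: "0 < \<alpha>"
  defines "X \<equiv> sandwiched_output \<alpha> W"
  defines "F \<equiv> trace_powr (X False) \<alpha> + trace_powr (X True) \<alpha>"
  obtains V A B m where "bcq_channel V"
    "dim_row A = out_dim W" "dim_row B = out_dim W" "dim_col A = m" "dim_col B = m"
    "A * mat_adjoint A = X False + X True" "B * mat_adjoint B = X False + X True"
    "A * mat_adjoint B = X False - X True" "B * mat_adjoint A = X False - X True"
    "sandwiched_output \<alpha> V False = complex_of_real (F powr (- 1 / \<alpha>) / 2) \<cdot>\<^sub>m (mat_adjoint A * A)"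
    "sandwiched_output \<alpha> V True = complex_of_real (F powr (- 1 / \<alpha>) / 2) \<cdot>\<^sub>m (mat_adjoint B * B)"
proof -
  have X: "psd_mat (out_dim W) (X x)" for x unfolding X_def by (rule sandwiched_output_psd[OF W])
  obtain m A B d where dims: "dim_row A = out_dim W" "dim_row B = out_dim W" "dim_col A = m" "dim_col B = m"
    and d: "\<And>i. 0 \<le> d i"
    and eqs: "A * mat_adjoint A = X False + X True" "B * mat_adjoint B = X False + X True"
    "A * mat_adjoint B = X False - X True" "B * mat_adjoint A = X False - X True"
    and sum: "mat_adjoint A * A + mat_adjoint B * B = 2 \<cdot>\<^sub>m mat_diag m (\<lambda>i. complex_of_real (d i))"
    and dA: "\<And>i. i < m \<Longrightarrow> (mat_adjoint A * A) $$ (i, i) = complex_of_real (d i)"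
    and dB: "\<And>i. i < m \<Longrightarrow> (mat_adjoint B * B) $$ (i, i) = complex_of_real (d i)"
    and F: "\<And>s. (\<Sum>i<m. d i powr s) = trace_powr (X False) s + trace_powr (X True) s"
    by (rule dual_factors[OF X[of False] X[of True]]) blast
  define M where "M x = (if x then B else A)" for x
  have pos: "0 < (\<Sum>i<m. d i powr \<alpha>)"
    using sandwiched_output_trace_pos[OF W \<alpha>] by (simp add: F X_def)
  have 1: "dim_col (M x) = m" for x by (simp add: M_def dims)
  have 2: "mat_adjoint (M False) * M False + mat_adjoint (M True) * M True = 2 \<cdot>\<^sub>m mat_diag m (\<lambda>i. complex_of_real (d i))"
    by (simp add: M_def sum)
  have 3: "(mat_adjoint (M x) * M x) $$ (i, i) = complex_of_real (d i)" if "i < m" for x i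
    using dA[OF that] dB[OF that] by (simp add: M_def del: index_mult_mat(1))
  note V = dual_channel[OF \<alpha> 1 d 2 3 pos]
  show ?thesis
    by (rule that[OF V(1) dims eqs]) (use V(3)[of False] V(3)[of True] in \<open>simp_all add: F F_def M_def\<close>)
qed

text \<open>The pair \<open>A \<otimes>\<^sub>m K\<close>, \<open>B \<otimes>\<^sub>m L\<close>
  satisfies the hypotheses of \<open>trace_powr_gram_sum\<close> with \<open>?Q\<close> and
  \<open>?C\<close>. Expanding \<open>?Q + ?C\<close> and \<open>?Q - ?C\<close> leaves twice the
  box matrices, whence the factor \<open>2 powr s\<close>.\<close>

lemma trace_powr_kron_gram_sum:
  assumes A: "dim_row A = n" "dim_col A = m" and B: "dim_row B = n" "dim_col B = m"
    and K: "dim_row K = p" "dim_col K = q" and L: "dim_row L = p" "dim_col L = q"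
    and AB: "A * mat_adjoint A = X0 + X1" "B * mat_adjoint B = X0 + X1"
      "A * mat_adjoint B = X0 - X1" "B * mat_adjoint A = X0 - X1"
    and KL: "K * mat_adjoint K = Y0 + Y1" "L * mat_adjoint L = Y0 + Y1"
      "K * mat_adjoint L = Y0 - Y1" "L * mat_adjoint K = Y0 - Y1"
    and X: "psd_mat n X0" "psd_mat n X1" and Y: "psd_mat p Y0" "psd_mat p Y1"
  shows "trace_powr ((mat_adjoint A * A) \<otimes>\<^sub>m (mat_adjoint K * K) + (mat_adjoint B * B) \<otimes>\<^sub>m (mat_adjoint L * L)) s =
    2 powr s * (trace_powr (X0 \<otimes>\<^sub>m Y0 + X1 \<otimes>\<^sub>m Y1) s + trace_powr (X0 \<otimes>\<^sub>m Y1 + X1 \<otimes>\<^sub>m Y0) s)"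
proof -
  note d = psd_dims[OF X(1)] psd_dims[OF X(2)] psd_dims[OF Y(1)] psd_dims[OF Y(2)]
  let ?Q = "(X0 + X1) \<otimes>\<^sub>m (Y0 + Y1)" and ?C = "(X0 - X1) \<otimes>\<^sub>m (Y0 - Y1)"
  have "trace_powr ((mat_adjoint A * A) \<otimes>\<^sub>m (mat_adjoint K * K) + (mat_adjoint B * B) \<otimes>\<^sub>m (mat_adjoint L * L)) s =
    trace_powr (mat_adjoint (A \<otimes>\<^sub>m K) * (A \<otimes>\<^sub>m K) + mat_adjoint (B \<otimes>\<^sub>m L) * (B \<otimes>\<^sub>m L)) s"
    using A B K L by (simp add: adjoint_kron kron_mult)
  also have "\<dots> = trace_powr (?Q + ?C) s + trace_powr (?Q - ?C) s"
    by (rule trace_powr_gram_sum[where p = "n * p" and q = "m * q"])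
      (use A B K L in \<open>simp_all add: adjoint_kron kron_mult AB KL\<close>)
  also have "?Q + ?C = complex_of_real 2 \<cdot>\<^sub>m (X0 \<otimes>\<^sub>m Y0 + X1 \<otimes>\<^sub>m Y1)"
    by (rule eq_matI) (auto simp: d less_mult_imp_div_less mod_less_of_mult, simp add: algebra_simps)
  also have "?Q - ?C = complex_of_real 2 \<cdot>\<^sub>m (X0 \<otimes>\<^sub>m Y1 + X1 \<otimes>\<^sub>m Y0)"
    by (rule eq_matI) (auto simp: d less_mult_imp_div_less mod_less_of_mult, simp add: algebra_simps)
  finally show ?thesis
    by (simp only: trace_powr_smult[OF psd_mat_add[OF psd_mat_kron[OF X(1) Y(1)] psd_mat_kron[OF X(2) Y(2)]]]
        trace_powr_smult[OF psd_mat_add[OF psd_mat_kron[OF X(1) Y(2)] psd_mat_kron[OF X(2) Y(1)]]]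
        zero_le_numeral distrib_left)
qed

section \<open>The duality identities for both channels and their box product\<close>

theorem lemmaV2:
  fixes \<alpha> :: real and W1 W2 :: bcq
  assumes "0 < \<alpha>" "\<alpha> \<noteq> 1"
    and "bcq_channel W1" "bcq_channel W2"
  shows "\<exists>V1 V2 :: bcq. bcq_channel V1 \<and> bcq_channel V2 \<and>
    channel_H \<alpha> V1 = ln 2 - channel_H \<alpha> W1 \<and>
    channel_H \<alpha> V2 = ln 2 - channel_H \<alpha> W2 \<and>
    box_H \<alpha> W1 W2 - 1 / 2 * (channel_H \<alpha> W1 + channel_H \<alpha> W2) =
    box_H \<alpha> V1 V2 - 1 / 2 * (channel_H \<alpha> V1 + channel_H \<alpha> V2)"
proof -
  note \<alpha> = assms(1,2) and W = assms(3,4)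
  define F where "F W = trace_powr (sandwiched_output \<alpha> W False) \<alpha> + trace_powr (sandwiched_output \<alpha> W True) \<alpha>" for W
  \<comment> \<open>The scalar that multiplies the Gram matrices in the sandwiched outputs of the
    dual channel.\<close>
  define c where "c W = F W powr (- 1 / \<alpha>) / 2" for W
  have F: "0 < F W" if "bcq_channel W" for W
    unfolding F_def by (rule sandwiched_output_trace_pos[OF that \<alpha>(1)])
  have cpos: "0 \<le> c W" for W by (simp add: c_def)
  have c: "c W powr \<alpha> = 1 / (2 powr \<alpha> * F W)" if "bcq_channel W" for W
  proof -
    have "c W powr \<alpha> = F W powr (- 1 / \<alpha> * \<alpha>) / 2 powr \<alpha>"
      by (simp only: c_def powr_divide powr_powr)
    also have "- 1 / \<alpha> * \<alpha> = - 1" using \<alpha>(1) by simp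
    finally show ?thesis using F[OF that] by (simp add: powr_neg_one)
  qed
  define X where "X W x = sandwiched_output \<alpha> W x" for W x
  have X: "psd_mat (out_dim W) (X W x)" if "bcq_channel W" for W x
    unfolding X_def by (rule sandwiched_output_psd[OF that])
  obtain V1 A B m where V1: "bcq_channel V1"
    and dA: "dim_row A = out_dim W1" "dim_row B = out_dim W1" "dim_col A = m" "dim_col B = m"
    and AB: "A * mat_adjoint A = X W1 False + X W1 True" "B * mat_adjoint B = X W1 False + X W1 True"
    "A * mat_adjoint B = X W1 False - X W1 True" "B * mat_adjoint A = X W1 False - X W1 True"
    and XV1: "X V1 False = complex_of_real (c W1) \<cdot>\<^sub>m (mat_adjoint A * A)"
    "X V1 True = complex_of_real (c W1) \<cdot>\<^sub>m (mat_adjoint B * B)"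
    using dual_channel_exists[OF W(1) \<alpha>(1)] unfolding X_def c_def F_def by blast
  obtain V2 K L q where V2: "bcq_channel V2"
    and dK: "dim_row K = out_dim W2" "dim_row L = out_dim W2" "dim_col K = q" "dim_col L = q"
    and KL: "K * mat_adjoint K = X W2 False + X W2 True" "L * mat_adjoint L = X W2 False + X W2 True"
    "K * mat_adjoint L = X W2 False - X W2 True" "L * mat_adjoint K = X W2 False - X W2 True"
    and XV2: "X V2 False = complex_of_real (c W2) \<cdot>\<^sub>m (mat_adjoint K * K)"
    "X V2 True = complex_of_real (c W2) \<cdot>\<^sub>m (mat_adjoint L * L)"
    using dual_channel_exists[OF W(2) \<alpha>(1)] unfolding X_def c_def F_def by blast
  have one: "trace_powr (X W False + X W True) \<alpha> = 1" if "bcq_channel W" for W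
    unfolding X_def by (rule trace_powr_sandwiched_output_sum[OF that \<alpha>(1)])
  \<comment> \<open>The Gram matrix may be replaced by \<open>M * mat_adjoint M\<close>, whose power
    \<alpha> has trace 1 by \<open>one\<close>.\<close>
  have gram: "trace_powr (complex_of_real r \<cdot>\<^sub>m (mat_adjoint M * M)) \<alpha> = r powr \<alpha>"
    if "0 \<le> r" "bcq_channel W" "M * mat_adjoint M = X W False + X W True" for r M W
    using trace_powr_gram_commute[of M \<alpha>] one[OF that(2)] that(1,3)
    by (simp add: trace_powr_smult[OF psd_mat_gram'[OF refl]])
  have two: "2 powr (1 - \<alpha>) = 2 / 2 powr \<alpha>" by (simp add: powr_diff)
  \<comment> \<open>Both outputs contribute \<open>c W powr \<alpha>\<close>, and twice this value
    is \<open>2 powr (1 - \<alpha>) / F W\<close>.\<close>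
  have FV: "F V1 = 2 powr (1 - \<alpha>) / F W1" "F V2 = 2 powr (1 - \<alpha>) / F W2"
    unfolding F_def[of V1] F_def[of V2] X_def[symmetric] XV1 XV2 two
      gram[OF cpos W(1) AB(1)] gram[OF cpos W(1) AB(2)] gram[OF cpos W(2) KL(1)] gram[OF cpos W(2) KL(2)]
      c[OF W(1)] c[OF W(2)] by simp_all
  have H: "channel_H \<alpha> W = 1 / (1 - \<alpha>) * ln (F W)" if "bcq_channel W" for W
    unfolding F_def by (rule channel_H_eq[OF that])
  have ln2: "1 / (1 - \<alpha>) * ln (2 powr (1 - \<alpha>)) = ln 2"
    using \<alpha>(2) by (simp add: ln_powr)
  have ln_FV: "ln (2 powr (1 - \<alpha>) / F W) = ln (2 powr (1 - \<alpha>)) - ln (F W)" if "bcq_channel W" for W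
    using F[OF that] by (simp add: ln_div)
  have HV: "channel_H \<alpha> V1 = ln 2 - channel_H \<alpha> W1" "channel_H \<alpha> V2 = ln 2 - channel_H \<alpha> W2"
    by (simp_all only: H[OF V1] H[OF V2] H[OF W(1)] H[OF W(2)] FV ln_FV[OF W(1)] ln_FV[OF W(2)] right_diff_distrib ln2)
  define G where "G W W' = trace_powr (X W False \<otimes>\<^sub>m X W' False + X W True \<otimes>\<^sub>m X W' True) \<alpha> +
     trace_powr (X W False \<otimes>\<^sub>m X W' True + X W True \<otimes>\<^sub>m X W' False) \<alpha>" for W W'
  have box: "box_H \<alpha> W W' = 1 / (1 - \<alpha>) * ln (G W W')" if "bcq_channel W" "bcq_channel W'" for W W'
    unfolding G_def X_def by (rule box_H_eq[OF that])
  have G: "0 < G W1 W2"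
    unfolding G_def X_def by (rule box_trace_pos[OF W \<alpha>(1)])
  have scale: "(complex_of_real r \<cdot>\<^sub>m M) \<otimes>\<^sub>m (complex_of_real t \<cdot>\<^sub>m N) + (complex_of_real r \<cdot>\<^sub>m M') \<otimes>\<^sub>m (complex_of_real t \<cdot>\<^sub>m N') =
      complex_of_real (r * t) \<cdot>\<^sub>m (M \<otimes>\<^sub>m N + M' \<otimes>\<^sub>m N')"
    if "dim_row M' = dim_row M" "dim_col M' = dim_col M" "dim_row N' = dim_row N" "dim_col N' = dim_col N" for r t M N M' N'
    using that by (intro eq_matI) (auto simp: less_mult_imp_div_less mod_less_of_mult algebra_simps)
  have term1: "trace_powr (X V1 False \<otimes>\<^sub>m X V2 False + X V1 True \<otimes>\<^sub>m X V2 True) \<alpha> = (c W1 * c W2) powr \<alpha> * (2 powr \<alpha> * G W1 W2)"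
  proof -
    have "psd_mat (m * q) ((mat_adjoint A * A) \<otimes>\<^sub>m (mat_adjoint K * K) + (mat_adjoint B * B) \<otimes>\<^sub>m (mat_adjoint L * L))"
      using dA dK by (intro psd_mat_add psd_mat_kron psd_mat_gram')
    moreover have "trace_powr ((mat_adjoint A * A) \<otimes>\<^sub>m (mat_adjoint K * K) + (mat_adjoint B * B) \<otimes>\<^sub>m (mat_adjoint L * L)) \<alpha> =
        2 powr \<alpha> * G W1 W2"
      unfolding G_def
      by (rule trace_powr_kron_gram_sum[OF dA(1,3) dA(2,4) dK(1,3) dK(2,4) AB KL X X X X]) (rule W)+
    ultimately show ?thesis
      using dA dK cpos[of W1] cpos[of W2] by (simp add: XV1 XV2 scale trace_powr_smult del: of_real_mult)
  qed
  \<comment> \<open>The relations between \<open>K\<close> and \<open>L\<close> are symmetric, so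
    exchanging the two gives the same value as in \<open>term1\<close>.\<close>
  have term2: "trace_powr (X V1 False \<otimes>\<^sub>m X V2 True + X V1 True \<otimes>\<^sub>m X V2 False) \<alpha> = (c W1 * c W2) powr \<alpha> * (2 powr \<alpha> * G W1 W2)"
  proof -
    have "psd_mat (m * q) ((mat_adjoint A * A) \<otimes>\<^sub>m (mat_adjoint L * L) + (mat_adjoint B * B) \<otimes>\<^sub>m (mat_adjoint K * K))"
      using dA dK by (intro psd_mat_add psd_mat_kron psd_mat_gram')
    moreover have "trace_powr ((mat_adjoint A * A) \<otimes>\<^sub>m (mat_adjoint L * L) + (mat_adjoint B * B) \<otimes>\<^sub>m (mat_adjoint K * K)) \<alpha> =
        2 powr \<alpha> * G W1 W2"
      unfolding G_def
      by (rule trace_powr_kron_gram_sum[OF dA(1,3) dA(2,4) dK(2,4) dK(1,3) AB KL(2,1,4,3) X X X X]) (rule W)+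
    ultimately show ?thesis
      using dA dK cpos[of W1] cpos[of W2] by (simp add: XV1 XV2 scale trace_powr_smult del: of_real_mult)
  qed
  \<comment> \<open>The powers of 2 are 1 from the two equal terms, \<alpha> from the Gram sum and -
    2 \<alpha> from the scalars, in total 1 - \<alpha>.\<close>
  have "G V1 V2 = 2 * ((c W1 * c W2) powr \<alpha> * (2 powr \<alpha> * G W1 W2))"
    by (simp add: G_def[of V1 V2] term1 term2)
  also have "\<dots> = 2 powr (1 - \<alpha>) * G W1 W2 / (F W1 * F W2)"
    by (simp add: powr_mult c W two)
  finally have GV: "G V1 V2 = 2 powr (1 - \<alpha>) * G W1 W2 / (F W1 * F W2)" .
  have "ln (G V1 V2) = ln (2 powr (1 - \<alpha>)) + ln (G W1 W2) - (ln (F W1) + ln (F W2))"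
    using G F[OF W(1)] F[OF W(2)] by (simp add: GV ln_div ln_mult)
  then have "box_H \<alpha> V1 V2 = ln 2 + box_H \<alpha> W1 W2 - (channel_H \<alpha> W1 + channel_H \<alpha> W2)"
    by (simp only: box[OF V1 V2] box[OF W] H[OF W(1)] H[OF W(2)] right_diff_distrib distrib_left ln2)
  \<comment> \<open>Half the sum of the dual entropies is \<open>ln 2\<close> minus half the sum of
    the original ones, so the two occurrences of \<open>ln 2\<close> cancel.\<close>
  then show ?thesis using V1 V2 HV by (intro exI[of _ V1] exI[of _ V2]) (simp add: field_simps)
qed

end
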